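(* Let $k\ge1$ be an integer. For every graphing $\mathbf{G}=(I,\mathcal{A},\lambda,E)$, \[ \mathrm{sep}_k^*(\mathbf{G})=\sup_g\frac12\int_I g\,d\lambda, \] where $g$ ranges over all bounded Borel functions $g:I\to\mathbb{R}$ such that $\overline{g}(Y)\le h(Y)$ for all $Y\in\mathcal{R}_k$ (equivalently, $\sum_{y\in Y}g(y)\le|\partial Y|$ for all $Y\in\mathcal{R}_k$).
   Context: Fix an integer $D\ge1$. A graphing is a Borel graph $\mathbf{G}=(I,\mathcal{A},\lambda,E)$ on a standard probability space $(I,\mathcal{A},\lambda)$, with symmetric Borel edge set $E\subseteq I\times I$ and all degrees at most $D$, satisfying $\int_A\deg_B(x)\,d\lambda(x)=\int_B\deg_A(x)\,d\lambda(x)$ for all Borel $A,B\subseteq I$, where $\deg_B(x)$ is the number of edges from $x$ to points of $B$. Let $\mathcal{R}_k$ be the set of subsets of $I$ with between $1$ and $k$ elements inducing a connected subgraph of $\mathbf{G}$, regarded (via listing elements) as a Borel subset of $I\cup I^2\cup\dots\cup I^k$. For a finite measure $\tau$ on $\mathcal{R}_k$, its marginal is $\tau'(X)=\int_{\mathcal{R}_k}\frac{|X\cap Y|}{|Y|}\,d\tau(Y)$ for Borel $X\subseteq I$. A fractional $\mathcal{R}_k$-partition is a probability measure $\tau$ on $\mathcal{R}_k$ with $\tau'=\lambda$. For finite $Y\subseteq I$, $\partial Y$ is the set of edges from $Y$ to $I\setminus Y$, $h(Y)=|\partial Y|/|Y|$, and for $g:I\to\mathbb{R}$, $\overline{g}(Y)=\frac1{|Y|}\sum_{y\in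 Y}g(y)$. Define $\mathrm{sep}_k^*(\mathbf{G})=\frac12\inf_\tau\int_{\mathcal{R}_k}h\,d\tau$ over all fractional $\mathcal{R}_k$-partitions $\tau$. *)

theory Defs
  imports "HOL-Probability.Probability"
begin

text \<open>
  A measurable space is standard Borel if its \<sigma>-algebra is generated by the open sets of a
  Polish topology (which is not part of the structure). Note that \<^term>\<open>space M\<close> is then
  \<^term>\<open>topspace X\<close>.
\<close>

definition standard_borel_space :: "'a measure \<Rightarrow> bool" where
  "standard_borel_space M \<longleftrightarrow>
     (\<exists>X. completely_metrizable_space X \<and> second_countable X \<and>
          sets M = sigma_sets (topspace X) {U. openin X U})"

definition nbrs_in :: "('a \<times> 'a) set \<Rightarrow> 'a set \<Rightarrow> 'a \<Rightarrow> 'a set" where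
  "nbrs_in E B x = {y \<in> B. (x, y) \<in> E}"

definition deg_in :: "('a \<times> 'a) set \<Rightarrow> 'a set \<Rightarrow> 'a \<Rightarrow> nat" where
  "deg_in E B x = card (nbrs_in E B x)"

text \<open>
  Measurability of \<^term>\<open>deg_in E B\<close> is not assumed: it holds automatically on a standard Borel
  space. Loops are not excluded; they affect neither connectedness nor edge boundaries.
\<close>

locale graphing = prob_space M for D :: nat and M :: "'a measure" and E :: "('a \<times> 'a) set" +
  assumes standard_borel: "standard_borel_space M"
    and edges_borel: "E \<in> sets (M \<Otimes>\<^sub>M M)"
    and edges_sym: "sym E"
    and finite_nbrs: "x \<in> space M \<Longrightarrow> finite (nbrs_in E (space M) x)"
    and deg_bound: "x \<in> space M \<Longrightarrow> deg_in E (space M) x \<le> D"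
    and measure_preserving:
      "A \<in> sets M \<Longrightarrow> B \<in> sets M \<Longrightarrow>
       (\<integral>\<^sup>+x\<in>A. of_nat (deg_in E B x) \<partial>M) = (\<integral>\<^sup>+x\<in>B. of_nat (deg_in E A x) \<partial>M)"

definition induces_connected :: "('a \<times> 'a) set \<Rightarrow> 'a set \<Rightarrow> bool" where
  "induces_connected E Y \<longleftrightarrow> (\<forall>x\<in>Y. \<forall>y\<in>Y. (x, y) \<in> (E \<inter> Y \<times> Y)\<^sup>*)"

text \<open>Since \<open>card Y = 0\<close> for infinite \<open>Y\<close>, the bound \<open>1 \<le> card Y\<close> forces \<open>Y\<close> to be finite.\<close>

definition conn_sets :: "'a measure \<Rightarrow> ('a \<times> 'a) set \<Rightarrow> nat \<Rightarrow> 'a set set" where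
  "conn_sets M E k =
     {Y. Y \<subseteq> space M \<and> 1 \<le> card Y \<and> card Y \<le> k \<and> induces_connected E Y}"

definition listings :: "'a measure \<Rightarrow> nat \<Rightarrow> 'a set set \<Rightarrow> (nat \<Rightarrow> 'a) set" where
  "listings M m F = {x \<in> space (\<Pi>\<^sub>M i\<in>{..<m}. M). inj_on x {..<m} \<and> x ` {..<m} \<in> F}"

text \<open>
  The Borel structure on \<^term>\<open>conn_sets M E k\<close>: a family \<open>F\<close> is measurable iff, for every \<open>m\<close>,
  the set of all injective listings of its \<open>m\<close>-element members is Borel in the \<open>m\<close>-th power of
  \<open>M\<close>. For a graphing these families already form a \<sigma>-algebra. The measure component of this
  space is irrelevant.
\<close>

definition conn_space :: "'a measure \<Rightarrow> ('a \<times> 'a) set \<Rightarrow> nat \<Rightarrow> 'a set measure" where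
  "conn_space M E k = sigma (conn_sets M E k)
     {F. F \<subseteq> conn_sets M E k \<and> (\<forall>m. listings M m F \<in> sets (\<Pi>\<^sub>M i\<in>{..<m}. M))}"

definition marginal :: "'a set measure \<Rightarrow> 'a set \<Rightarrow> ennreal" where
  "marginal \<tau> X = (\<integral>\<^sup>+Y. ennreal (real (card (X \<inter> Y)) / real (card Y)) \<partial>\<tau>)"

definition fractional_partitions ::
  "'a measure \<Rightarrow> ('a \<times> 'a) set \<Rightarrow> nat \<Rightarrow> 'a set measure set" where
  "fractional_partitions M E k =
     {\<tau>. prob_space \<tau> \<and> sets \<tau> = sets (conn_space M E k) \<and>
         (\<forall>X\<in>sets M. marginal \<tau> X = emeasure M X)}"

text \<open>Each undirected boundary edge is counted once, as the pair oriented out of \<open>Y\<close>.\<close>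

definition edge_boundary :: "('a \<times> 'a) set \<Rightarrow> 'a set \<Rightarrow> ('a \<times> 'a) set" where
  "edge_boundary E Y = {(x, y) \<in> E. x \<in> Y \<and> y \<notin> Y}"

definition expansion :: "('a \<times> 'a) set \<Rightarrow> 'a set \<Rightarrow> real" where
  "expansion E Y = real (card (edge_boundary E Y)) / real (card Y)"

definition average :: "('a \<Rightarrow> real) \<Rightarrow> 'a set \<Rightarrow> real" where
  "average g Y = (1 / real (card Y)) * (\<Sum>y\<in>Y. g y)"

text \<open>
  The infimum is over a set of reals. For a graphing and \<open>k \<ge> 1\<close> this set is nonempty (push \<^term>\<open>M\<close>
  forward along \<open>x \<mapsto> {x}\<close>) and bounded below by \<open>0\<close>, and the integrand takes values in \<open>[0, D]\<close>.
\<close>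

definition sep_star :: "'a measure \<Rightarrow> ('a \<times> 'a) set \<Rightarrow> nat \<Rightarrow> real" where
  "sep_star M E k =
     1 / 2 * (INF \<tau>\<in>fractional_partitions M E k. \<integral>Y. expansion E Y \<partial>\<tau>)"

end

theory Submission
  imports Defs
begin

text \<open>
  Weak duality is Fubini's theorem for the kernel that sends \<open>Y\<close> to the uniform distribution on
  \<open>Y\<close>. For the converse, the functional sending a bounded function \<open>f\<close> on the connected sets to
  the infimum of \<open>\<integral>g\<close> over all \<open>g\<close> whose averages dominate \<open>f\<close> is sublinear. The Hahn--Banach
  theorem gives a positive functional \<open>L\<close> below it that agrees with it at \<open>-h\<close>; then \<open>L\<close> sends the
  averages of \<open>g\<close> to \<open>\<integral>g\<close>, and \<open>L h\<close> is the supremum in question. Since each vertex lies in only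
  finitely many connected sets with at most \<open>k\<close> elements, a decreasing sequence of families with
  empty intersection covers a decreasing sequence of vertex sets with empty intersection, so \<open>L\<close> is
  automatically countably additive and is an optimal fractional partition.

  The measurability of degrees, boundaries and vertex sets of families rests on the theorem that a
  Borel set with boundedly many points in each fibre has a Borel projection. Coding by Baire space
  reduces this to a closed set; Borel sets that separate the pieces over cylinders of a given
  length in such a way that every point lies in boundedly many of them then recover the
  projection by Koenig's lemma.
\<close>

subsection \<open>Prefixes and unique projections in Baire space\<close>

text \<open>Strong duality is reached by exhibiting an optimal fractional partition. A graphing
  comes without a topology in which weak limits of fractional partitions would preserve marginals
  and the integral of \<open>expansion E\<close>, so a minimizing sequence is of no use; the optimum
  is built from the dual side, on all bounded functions at once, where measurability is not yet an
  issue. The price is that only finite additivity comes for free. To repair this, the vertex set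
  covered by a measurable family must itself be Borel. That set is a projection, hence a priori
  merely analytic, and this is why descriptive set theory enters a duality proof. The bound on
  degrees is used there in one form: \<open>D + 1\<close> pieces of a fibre over disjoint cylinders
  have no common base point. Two pieces may well overlap, so separation of two disjoint analytic
  sets would not be enough, and separation is proved for any finite family with empty
  intersection.\<close>

definition prefix_of :: "nat \<Rightarrow> (nat \<Rightarrow> nat) \<Rightarrow> nat list" where
  "prefix_of n z = map z [0..<n]"

lemma length_prefix_of [simp]: "length (prefix_of n z) = n"
  by (simp add: prefix_of_def)

lemma prefix_of_0 [simp]: "prefix_of 0 z = []"
  by (simp add: prefix_of_def)

lemma prefix_of_Suc: "prefix_of (Suc n) z = prefix_of n z @ [z n]"
  by (simp add: prefix_of_def)

lemma take_prefix_of: "m \<le> n \<Longrightarrow> take m (prefix_of n z) = prefix_of m z"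
  by (simp add: prefix_of_def take_map)

lemma prefix_of_eq_iff: "prefix_of n y = prefix_of n z \<longleftrightarrow> (\<forall>i<n. y i = z i)"
  by (auto simp: prefix_of_def)

lemma prefix_of_mono: "prefix_of n y = prefix_of n z \<Longrightarrow> m \<le> n \<Longrightarrow> prefix_of m y = prefix_of m z"
  by (auto simp: prefix_of_eq_iff)

lemma open_prefix_of: "open {z. prefix_of n z = l}"
proof -
  have "{z. prefix_of n z = l} = (if length l = n then (\<Inter>i\<in>{..<n}. (\<lambda>z. z i) -` {l ! i}) else {})"
    by (auto simp: prefix_of_def list_eq_iff_nth_eq)
  moreover have "open ((\<lambda>z::nat\<Rightarrow>nat. z i) -` {l ! i})" for i
    by (rule open_vimage[OF _ continuous_on_product_coordinates]) (rule discrete_topology_class.open_discrete)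
  ultimately show ?thesis by (auto intro!: open_INT)
qed

lemma closed_prefix_of: "closed {z. prefix_of n z = l}"
proof -
  have "- {z. prefix_of n z = l} = (\<Union>l'\<in>{l'. l' \<noteq> l}. {z. prefix_of n z = l'})" by auto
  then have "open (- {z. prefix_of n z = l})" by (auto intro: open_prefix_of)
  then show ?thesis by (simp add: closed_def)
qed

lemma borel_prefix_of: "{z. prefix_of n z = l} \<in> sets borel"
  by (intro borel_open open_prefix_of)

lemma open_imp_prefix_of:
  assumes "open U" "x \<in> U"
  obtains n where "\<And>y. prefix_of n y = prefix_of n x \<Longrightarrow> y \<in> U"
proof -
  from assms have "openin (product_topology (\<lambda>i. euclidean) UNIV) U"
    by (simp add: open_fun_def)
  from product_topology_open_contains_basis[OF this \<open>x \<in> U\<close>]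
  obtain X :: "nat \<Rightarrow> nat set" where X: "x \<in> (\<Pi>\<^sub>E i\<in>UNIV. X i)" "finite {i. X i \<noteq> UNIV}"
      "(\<Pi>\<^sub>E i\<in>UNIV. X i) \<subseteq> U"
    by auto
  obtain n where n: "\<And>i. X i \<noteq> UNIV \<Longrightarrow> i < n"
    using finite_nat_bounded[OF X(2)] by auto
  have "y \<in> U" if "prefix_of n y = prefix_of n x" for y
  proof -
    have "y i \<in> X i" for i
      using X(1) n[of i] that by (cases "X i = UNIV") (auto simp: prefix_of_eq_iff)
    then show ?thesis using X(3) by auto
  qed
  then show thesis by (rule that)
qed

lemma open_imp_prefix_of_pair:
  assumes "open U" "(x, y) \<in> U"
  obtains n where "\<And>x' y'. prefix_of n x' = prefix_of n x \<Longrightarrow> prefix_of n y' = prefix_of n y \<Longrightarrow> (x', y') \<in> U"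
proof -
  obtain A B where AB: "open A" "open B" "x \<in> A" "y \<in> B" "A \<times> B \<subseteq> U"
    using assms by (auto elim: open_prod_elim)
  obtain m where m: "\<And>x'. prefix_of m x' = prefix_of m x \<Longrightarrow> x' \<in> A"
    by (rule open_imp_prefix_of[OF AB(1,3)]) blast
  obtain n where n: "\<And>y'. prefix_of n y' = prefix_of n y \<Longrightarrow> y' \<in> B"
    by (rule open_imp_prefix_of[OF AB(2,4)]) blast
  show thesis
  proof (rule that[of "max m n"])
    fix x' y' assume "prefix_of (max m n) x' = prefix_of (max m n) x"
      "prefix_of (max m n) y' = prefix_of (max m n) y"
    then have "prefix_of m x' = prefix_of m x" "prefix_of n y' = prefix_of n y"
      by (auto intro: prefix_of_mono)
    then have "x' \<in> A" "y' \<in> B" by (auto intro: m n)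
    then show "(x', y') \<in> U" using AB(5) by blast
  qed
qed

lemma closed_prefix_ofD:
  assumes "closed C"
    and "\<And>n. \<exists>x' y'. (x', y') \<in> C \<and> prefix_of n x' = prefix_of n x \<and> prefix_of n y' = prefix_of n y"
  shows "(x, y) \<in> C"
proof (rule ccontr)
  assume "(x, y) \<notin> C"
  then have *: "open (- C)" "(x, y) \<in> - C" using assms(1) by auto
  obtain n where "\<And>x' y'. prefix_of n x' = prefix_of n x \<Longrightarrow> prefix_of n y' = prefix_of n y \<Longrightarrow> (x', y') \<in> - C"
    by (rule open_imp_prefix_of_pair[OF *]) blast
  then show False using assms(2)[of n] by blast
qed

text \<open>Clopen sets, unlike open ones, are stable under complements as well as intersections, so
  an induction over this generator can treat a set and its complement together.\<close>

lemma borel_eq_sigma_clopen: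
  "sets (borel :: ((nat \<Rightarrow> nat) \<times> (nat \<Rightarrow> nat)) measure) = sigma_sets UNIV {A. open A \<and> closed A}"
proof -
  let ?G = "{A :: ((nat \<Rightarrow> nat) \<times> (nat \<Rightarrow> nat)) set. open A \<and> closed A}"
  let ?c = "\<lambda>n (a, b). {z. prefix_of n z = a} \<times> {z. prefix_of n z = b}"
  have c: "?c n l \<in> ?G" for n l
    by (auto intro!: open_Times closed_Times open_prefix_of closed_prefix_of split: prod.split)
  have "U \<in> sigma_sets UNIV ?G" if "open U" for U
  proof -
    have "U = (\<Union>(n, l) \<in> {(n, l). ?c n l \<subseteq> U}. ?c n l)"
    proof (intro set_eqI iffI)
      fix p assume "p \<in> U"
      obtain x y where p: "p = (x, y)" by (cases p)
      obtain n where "\<And>x' y'. prefix_of n x' = prefix_of n x \<Longrightarrow> prefix_of n y' = prefix_of n y \<Longrightarrow> (x', y') \<in> U"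
        using open_imp_prefix_of_pair[of U x y] \<open>open U\<close> \<open>p \<in> U\<close> p by auto
      then have "?c n (prefix_of n x, prefix_of n y) \<subseteq> U" "p \<in> ?c n (prefix_of n x, prefix_of n y)"
        using p by auto
      then show "p \<in> (\<Union>(n, l) \<in> {(n, l). ?c n l \<subseteq> U}. ?c n l)" by (intro UN_I[of "(n, prefix_of n x, prefix_of n y)"]) auto
    qed auto
    moreover have "(\<Union>(n, l) \<in> {(n, l). ?c n l \<subseteq> U}. ?c n l) \<in> sigma_sets UNIV ?G"
      by (rule sigma_sets_UNION) (use c in \<open>auto intro!: sigma_sets.Basic\<close>)
    ultimately show ?thesis by simp
  qed
  then have "sigma_sets UNIV {U. open U} \<subseteq> sigma_sets UNIV ?G"
    by (intro sigma_sets_mono) auto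
  moreover have "sigma_sets UNIV ?G \<subseteq> sigma_sets UNIV {U. open U}"
    by (intro sigma_sets_mono) auto
  ultimately show ?thesis by (simp add: sets_borel)
qed

section \<open>Borel sets as injective projections of closed sets\<close>

lemma continuous_on_snd_coordinate:
  "continuous_on UNIV (\<lambda>p :: 't::topological_space \<times> (nat \<Rightarrow> nat). snd p k)"
  by (intro continuous_on_product_then_coordinatewise[where f = snd] continuous_on_snd continuous_on_id)

text \<open>This is the classical description of a Borel set by a closed set in the product with
  Baire space. Injectivity is what lets fibre cardinalities survive the passage from a Borel
  relation to a closed one.\<close>

definition unique_projection :: "'t::topological_space set \<Rightarrow> bool" where
  "unique_projection A \<longleftrightarrow>
     (\<exists>C :: ('t \<times> (nat \<Rightarrow> nat)) set. closed C \<and> fst ` C = A \<and> inj_on fst C)"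

lemma unique_projection_closed: "closed A \<Longrightarrow> unique_projection A"
  unfolding unique_projection_def
proof (intro exI conjI)
  assume "closed A"
  have "{\<lambda>_ :: nat. 0 :: nat} = (\<Inter>n. {z. prefix_of n z = prefix_of n (\<lambda>_. 0)})"
    by (auto simp: prefix_of_eq_iff)
  then have "closed {\<lambda>_ :: nat. 0 :: nat}"
    by (auto intro!: closed_INT closed_prefix_of)
  then show "closed (A \<times> {\<lambda>_ :: nat. 0 :: nat})"
    using \<open>closed A\<close> by (rule closed_Times[rotated])
qed (auto simp: inj_on_def)

lemma unique_projection_INT:
  fixes A :: "nat \<Rightarrow> 't::topological_space set"
  assumes "\<And>i. unique_projection (A i)"
  shows "unique_projection (\<Inter>i. A i)"
proof -
  obtain C :: "nat \<Rightarrow> ('t \<times> (nat \<Rightarrow> nat)) set"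
    where C: "\<And>i. closed (C i)" "\<And>i. fst ` C i = A i" "\<And>i. inj_on fst (C i)"
    using assms unfolding unique_projection_def by metis
  \<comment> \<open>One sequence codes countably many: row \<open>i\<close> of \<open>s\<close>
    under \<open>prod_encode\<close> serves as the witness for membership in
    \<open>A i\<close>.\<close>
  define f where "f i = (\<lambda>(p :: 't, s :: nat \<Rightarrow> nat). (p, \<lambda>n. s (prod_encode (i, n))))" for i
  have "continuous_on UNIV (f i)" for i
    unfolding f_def case_prod_unfold
    by (intro continuous_on_Pair continuous_on_coordinatewise_then_product
        continuous_on_snd_coordinate continuous_on_fst continuous_on_id)
  then have "closed (\<Inter>i. f i -` C i)"
    by (intro closed_INT ballI closed_vimage C)
  moreover have "fst ` (\<Inter>i. f i -` C i) = (\<Inter>i. A i)"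
  proof (intro set_eqI iffI)
    fix p assume "p \<in> (\<Inter>i. A i)"
    then have "p \<in> fst ` C i" for i using C(2) by auto
    then have "\<forall>i. \<exists>s. (p, s) \<in> C i" by (force simp: image_iff)
    then obtain S where S: "\<And>i. (p, S i) \<in> C i" by metis
    have "(p, \<lambda>m. case_prod S (prod_decode m)) \<in> (\<Inter>i. f i -` C i)"
      using S by (auto simp: f_def)
    then show "p \<in> fst ` (\<Inter>i. f i -` C i)" by (rule image_eqI[rotated]) simp
  next
    fix p assume "p \<in> fst ` (\<Inter>i. f i -` C i)"
    then obtain s where "(p, s) \<in> (\<Inter>i. f i -` C i)" by auto
    then have s: "f i (p, s) \<in> C i" for i by blast
    have "fst (f i (p, s)) \<in> A i" for i using s C(2) by blast
    then show "p \<in> (\<Inter>i. A i)" by (simp add: f_def)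
  qed
  moreover have "inj_on fst (\<Inter>i. f i -` C i)"
  proof (rule inj_onI, clarsimp)
    fix p s s' assume H: "\<forall>i. f i (p, s) \<in> C i" "\<forall>i. f i (p, s') \<in> C i"
    have "f i (p, s) = f i (p, s')" for i
      using H by (intro inj_onD[OF C(3)[of i]]) (auto simp: f_def)
    then have "s (prod_encode (i, n)) = s' (prod_encode (i, n))" for i n
      unfolding f_def by (metis case_prod_conv prod.inject)
    then show "s = s'" by (metis ext prod_decode_inverse surj_pair)
  qed
  ultimately show ?thesis unfolding unique_projection_def by blast
qed

text \<open>The first entry of a witness names the piece and the remaining entries are a witness for
  that piece; disjointness makes the name unique, as injectivity requires.\<close>

lemma unique_projection_disjoint_UN:
  fixes A :: "nat \<Rightarrow> 't::topological_space set"
  assumes "\<And>i. unique_projection (A i)" "disjoint_family A"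
  shows "unique_projection (\<Union>i. A i)"
proof -
  obtain C :: "nat \<Rightarrow> ('t \<times> (nat \<Rightarrow> nat)) set"
    where C: "\<And>i. closed (C i)" "\<And>i. fst ` C i = A i" "\<And>i. inj_on fst (C i)"
    using assms(1) unfolding unique_projection_def by metis
  define f where "f = (\<lambda>(p :: 't, s :: nat \<Rightarrow> nat). (p, \<lambda>n. s (Suc n)))"
  define h where "h = (\<lambda>(p :: 't, s :: nat \<Rightarrow> nat). s 0)"
  have f: "continuous_on UNIV f"
    unfolding f_def case_prod_unfold
    by (intro continuous_on_Pair continuous_on_coordinatewise_then_product
        continuous_on_snd_coordinate continuous_on_fst continuous_on_id)
  have h: "continuous_on UNIV h"
    unfolding h_def case_prod_unfold
    by (rule continuous_on_snd_coordinate)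
  have "closed (h -` (- {i}))" for i
    by (rule closed_vimage[OF _ h]) (simp add: closed_def discrete_topology_class.open_discrete)
  \<comment> \<open>Each set expresses the implication that \<open>s 0 = i\<close> puts the tail
    into \<open>C i\<close>. Its premise is a clopen condition, so the implication is
    closed.\<close>
  then have "closed (\<Inter>i. h -` (- {i}) \<union> f -` C i)"
    by (intro closed_INT ballI closed_Un closed_vimage[OF _ f] C)
  also have "(\<Inter>i. h -` (- {i}) \<union> f -` C i) = {(p, s). (p, \<lambda>n. s (Suc n)) \<in> C (s 0)}"
    by (auto simp: h_def f_def)
  finally have "closed {(p, s). (p, \<lambda>n. s (Suc n)) \<in> C (s 0)}" .
  moreover have "fst ` {(p, s). (p, \<lambda>n. s (Suc n)) \<in> C (s 0)} = (\<Union>i. A i)"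
  proof (intro set_eqI iffI)
    fix p assume "p \<in> (\<Union>i. A i)"
    then obtain i where "p \<in> fst ` C i" using C(2) by auto
    then obtain s where "(p, s) \<in> C i" by auto
    then have "(p, case_nat i s) \<in> {(p, s). (p, \<lambda>n. s (Suc n)) \<in> C (s 0)}" by simp
    then show "p \<in> fst ` {(p, s). (p, \<lambda>n. s (Suc n)) \<in> C (s 0)}" by (rule image_eqI[rotated]) simp
  next
    fix p assume "p \<in> fst ` {(p, s). (p, \<lambda>n. s (Suc n)) \<in> C (s 0)}"
    then obtain s where "(p, \<lambda>n. s (Suc n)) \<in> C (s 0)" by auto
    then have "p \<in> fst ` C (s 0)" by (rule image_eqI[rotated]) simp
    then have "p \<in> A (s 0)" by (simp add: C(2))
    then show "p \<in> (\<Union>i. A i)" by blast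
  qed
  moreover have "inj_on fst {(p, s). (p, \<lambda>n. s (Suc n)) \<in> C (s 0)}"
  proof (rule inj_onI, clarsimp)
    fix p s s' assume H: "(p, \<lambda>n. s (Suc n)) \<in> C (s 0)" "(p, \<lambda>n. s' (Suc n)) \<in> C (s' 0)"
    then have "p \<in> fst ` C (s 0)" "p \<in> fst ` C (s' 0)" by (auto intro: image_eqI[rotated])
    then have "p \<in> A (s 0)" "p \<in> A (s' 0)" by (simp_all add: C(2))
    then have 0: "s 0 = s' 0" using assms(2) by (auto simp: disjoint_family_on_def)
    have "(\<lambda>n. s (Suc n)) = (\<lambda>n. s' (Suc n))"
      using inj_onD[OF C(3) _ H(1), of "(p, \<lambda>n. s' (Suc n))"] H(2) 0 by simp
    then have "s n = s' n" for n using 0 by (cases n) (simp, metis)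
    then show "s = s'" by auto
  qed
  ultimately show ?thesis unfolding unique_projection_def by blast
qed

lemma borel_unique_projection:
  fixes A :: "((nat \<Rightarrow> nat) \<times> (nat \<Rightarrow> nat)) set"
  assumes "A \<in> sets borel"
  shows "unique_projection A"
proof -
  let ?G = "{A :: ((nat \<Rightarrow> nat) \<times> (nat \<Rightarrow> nat)) set. open A \<and> closed A}"
  have "Int_stable ?G" by (auto simp: Int_stable_def)
  moreover have "?G \<subseteq> Pow UNIV" by simp
  moreover have "A \<in> sigma_sets UNIV ?G"
    using assms by (simp add: borel_eq_sigma_clopen)
  \<comment> \<open>Carrying the complement along turns the complement of a disjoint union into an
    intersection, so the two closure lemmas cover every case.\<close>
  ultimately have "unique_projection A \<and> unique_projection (- A)"
  proof (induction rule: sigma_sets_induct_disjoint)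
    case (union A)
    then show ?case
      by (auto intro!: unique_projection_disjoint_UN unique_projection_INT simp: Compl_UN)
  qed (auto simp: Compl_eq_Diff_UNIV[symmetric] intro!: unique_projection_closed)
  then show ?thesis ..
qed

subsection \<open>Separation of finitely many analytic sets\<close>

text \<open>For two indices this is Lusin separation by disjoint Borel sets. More indices are needed
  because the pieces to be separated may overlap pairwise; only \<open>D + 1\<close> of them are
  known to have empty intersection.\<close>

definition borel_separable :: "'j set \<Rightarrow> ('j \<Rightarrow> 'x::topological_space set) \<Rightarrow> bool" where
  "borel_separable J A \<longleftrightarrow>
     (\<exists>S. (\<forall>j\<in>J. S j \<in> sets borel \<and> A j \<subseteq> S j) \<and> (\<Inter>j\<in>J. S j) = {})"

lemma borel_separable_cong:
  "(\<And>j. j \<in> J \<Longrightarrow> A j = B j) \<Longrightarrow> borel_separable J A \<longleftrightarrow> borel_separable J B"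
  by (auto simp: borel_separable_def)

text \<open>Induction on the set \<open>K\<close> of indices at which a single piece has been
  replaced by the union; the arbitrary family \<open>B\<close> supplies the sets at the remaining
  indices.\<close>

lemma borel_separable_UN_aux:
  fixes A :: "'j \<Rightarrow> nat \<Rightarrow> 'x::topological_space set"
  assumes "finite K" "K \<subseteq> J"
    and "\<And>\<nu>. borel_separable J (\<lambda>j. if j \<in> K then A j (\<nu> j) else B j)"
  shows "borel_separable J (\<lambda>j. if j \<in> K then \<Union>n. A j n else B j)"
  using assms
proof (induction K arbitrary: B rule: finite_induct)
  case empty
  then show ?case by simp
next
  case (insert k K)
  have "borel_separable J (\<lambda>j. if j \<in> K then \<Union>n. A j n else if j = k then A k n else B j)" for n
  proof (rule insert.IH)
    show "K \<subseteq> J" using insert.prems by simp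
    fix \<nu>
    have "(\<lambda>j. if j \<in> insert k K then A j ((\<nu>(k := n)) j) else B j)
        = (\<lambda>j. if j \<in> K then A j (\<nu> j) else if j = k then A k n else B j)"
      using insert.hyps by (auto simp: fun_eq_iff)
    then show "borel_separable J (\<lambda>j. if j \<in> K then A j (\<nu> j) else if j = k then A k n else B j)"
      using insert.prems(2)[of "\<nu>(k := n)"] by simp
  qed
  then have "\<forall>n. \<exists>S. (\<forall>j\<in>J. S j \<in> sets borel \<and>
      (if j \<in> K then \<Union>n. A j n else if j = k then A k n else B j) \<subseteq> S j) \<and> (\<Inter>j\<in>J. S j) = {}"
    unfolding borel_separable_def by blast
  then obtain S where "\<forall>n. (\<forall>j\<in>J. S n j \<in> sets borel \<and>
      (if j \<in> K then \<Union>n. A j n else if j = k then A k n else B j) \<subseteq> S n j) \<and> (\<Inter>j\<in>J. S n j) = {}"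
    unfolding choice_iff by blast
  then have S: "\<And>n j. j \<in> J \<Longrightarrow> S n j \<in> sets borel"
    "\<And>n j. j \<in> J \<Longrightarrow> (if j \<in> K then \<Union>n. A j n else if j = k then A k n else B j) \<subseteq> S n j"
    "\<And>n. (\<Inter>j\<in>J. S n j) = {}"
    by blast+
  \<comment> \<open>At the new index \<open>k\<close> a union of separators covers all pieces, while
    at the others an intersection serves every \<open>n\<close> at once: a common point picks some
    \<open>n\<close> at \<open>k\<close> and then lies in every \<open>S n j\<close>.\<close>
  let ?S = "\<lambda>j. if j = k then \<Union>n. S n k else \<Inter>n. S n j"
  have kJ: "k \<in> J" using insert.prems by auto
  have "(\<forall>j\<in>J. ?S j \<in> sets borel \<and> (if j \<in> insert k K then \<Union>n. A j n else B j) \<subseteq> ?S j)"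
  proof (intro ballI conjI)
    fix j assume j: "j \<in> J"
    show "?S j \<in> sets borel" using S(1) j kJ by auto
    show "(if j \<in> insert k K then \<Union>n. A j n else B j) \<subseteq> ?S j"
    proof (cases "j = k")
      case True
      have "A k n \<subseteq> S n k" for n using S(2)[OF kJ, of n] insert.hyps by simp
      then show ?thesis using True by auto
    next
      case False
      have "(if j \<in> insert k K then \<Union>n. A j n else B j) \<subseteq> S n j" for n
        using S(2)[OF j, of n] False by (auto split: if_splits)
      then show ?thesis using False by (simp add: le_INF_iff)
    qed
  qed
  moreover have "(\<Inter>j\<in>J. ?S j) = {}"
  proof (rule ccontr)
    assume "(\<Inter>j\<in>J. ?S j) \<noteq> {}"
    then obtain x where x: "\<And>j. j \<in> J \<Longrightarrow> x \<in> ?S j" by blast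
    from x[OF kJ] obtain n where "x \<in> S n k" by auto
    moreover have "x \<in> S n j" if "j \<in> J" "j \<noteq> k" for j using x[OF that(1)] that(2) by auto
    ultimately have "x \<in> (\<Inter>j\<in>J. S n j)" by auto
    then show False using S(3) by simp
  qed
  ultimately show ?case unfolding borel_separable_def by (intro exI[of _ ?S]) blast
qed

lemma borel_separable_UN:
  fixes A :: "'j \<Rightarrow> nat \<Rightarrow> 'x::topological_space set"
  assumes "finite J" "\<And>\<nu>. borel_separable J (\<lambda>j. A j (\<nu> j))"
  shows "borel_separable J (\<lambda>j. \<Union>n. A j n)"
proof -
  have "borel_separable J (\<lambda>j. if j \<in> J then A j (\<nu> j) else {})" for \<nu>
    by (rule iffD1[OF borel_separable_cong assms(2)[of \<nu>]]) simp
  from borel_separable_UN_aux[OF assms(1) order.refl this]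
  show ?thesis
    using borel_separable_cong[of J "\<lambda>j. if j \<in> J then \<Union>n. A j n else {}" "\<lambda>j. \<Union>n. A j n"]
    by simp
qed

text \<open>If separation failed, it would fail for some simultaneous one-step refinement at all
  indices, and repeating this yields a limit point in each projection. The limits cannot all agree,
  and two that differ are separated by cylinders of finite depth.\<close>

lemma borel_separable_analytic:
  fixes C :: "'j \<Rightarrow> ((nat \<Rightarrow> nat) \<times> (nat \<Rightarrow> nat)) set"
  assumes J: "finite J" and C: "\<And>j. j \<in> J \<Longrightarrow> closed (C j)" and empty: "(\<Inter>j\<in>J. fst ` C j) = {}"
  shows "borel_separable J (\<lambda>j. fst ` C j)"
proof (rule ccontr)
  \<comment> \<open>A list of pairs prescribes initial segments of both the point and its witness,
    so that refinement shrinks \<open>C j\<close> in both coordinates.\<close>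
  define A where "A j p = {x. \<exists>z. (x, z) \<in> C j \<and> prefix_of (length p) x = map fst p \<and>
      prefix_of (length p) z = map snd p}" for j and p :: "(nat \<times> nat) list"
  have A_UN: "A j p = (\<Union>m. A j (p @ [prod_decode m]))" for j p
  proof (intro set_eqI iffI)
    fix x assume "x \<in> A j p"
    then obtain z where "(x, z) \<in> C j" "prefix_of (length p) x = map fst p"
      "prefix_of (length p) z = map snd p"
      by (auto simp: A_def)
    then have "x \<in> A j (p @ [prod_decode (prod_encode (x (length p), z (length p)))])"
      by (auto simp: A_def prefix_of_Suc intro!: exI[of _ z])
    then show "x \<in> (\<Union>m. A j (p @ [prod_decode m]))" by blast
  qed (auto simp: A_def prefix_of_Suc)
  assume "\<not> borel_separable J (\<lambda>j. fst ` C j)"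
  moreover have "A j [] = fst ` C j" for j by (force simp: A_def image_iff)
  ultimately have base: "\<not> borel_separable J (\<lambda>j. A j [])" by simp
  have step: "\<exists>\<nu>. \<not> borel_separable J (\<lambda>j. A j (f j @ [prod_decode (\<nu> j)]))"
    if "\<not> borel_separable J (\<lambda>j. A j (f j))" for f
    using borel_separable_UN[OF J, of "\<lambda>j n. A j (f j @ [prod_decode n])"] that
    by (subst (asm) (2) A_UN) blast
  have "\<exists>F. \<forall>n. (\<not> borel_separable J (\<lambda>j. A j (F n j)) \<and> (\<forall>j. length (F n j) = n)) \<and>
      (\<exists>\<nu>. F (Suc n) = (\<lambda>j. F n j @ [prod_decode (\<nu> j)]))"
  proof (rule dependent_nat_choice)
    show "\<exists>f. \<not> borel_separable J (\<lambda>j. A j (f j)) \<and> (\<forall>j. length (f j) = 0)"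
      using base by (intro exI[of _ "\<lambda>_. []"]) auto
  next
    fix f n assume f: "\<not> borel_separable J (\<lambda>j. A j (f j)) \<and> (\<forall>j. length (f j) = n)"
    then obtain \<nu> where "\<not> borel_separable J (\<lambda>j. A j (f j @ [prod_decode (\<nu> j)]))"
      using step by blast
    then show "\<exists>g. (\<not> borel_separable J (\<lambda>j. A j (g j)) \<and> (\<forall>j. length (g j) = Suc n)) \<and>
        (\<exists>\<nu>. g = (\<lambda>j. f j @ [prod_decode (\<nu> j)]))"
      using f by (intro exI[of _ "\<lambda>j. f j @ [prod_decode (\<nu> j)]"]) auto
  qed
  then obtain F where F: "\<And>n. \<not> borel_separable J (\<lambda>j. A j (F n j))" "\<And>n j. length (F n j) = n"
    "\<And>n. \<exists>\<nu>. F (Suc n) = (\<lambda>j. F n j @ [prod_decode (\<nu> j)])"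
    by blast
  obtain \<nu> where \<nu>: "\<And>n. F (Suc n) = (\<lambda>j. F n j @ [prod_decode (\<nu> n j)])"
    using F(3) by metis
  define x where "x j n = fst (prod_decode (\<nu> n j))" for j n
  define z where "z j n = snd (prod_decode (\<nu> n j))" for j n
  have xz: "map fst (F n j) = prefix_of n (x j)" "map snd (F n j) = prefix_of n (z j)" for n j
  proof (induction n)
    case 0
    case 1
    show ?case using F(2)[of 0 j] by simp
    case 2
    show ?case using F(2)[of 0 j] by simp
  next
    case (Suc n)
    case 1
    show ?case using Suc by (simp add: \<nu> prefix_of_Suc x_def)
    case 2
    show ?case using Suc by (simp add: \<nu> prefix_of_Suc z_def)
  qed
  have "(x j, z j) \<in> C j" if j: "j \<in> J" for j
  proof (rule closed_prefix_ofD[OF C[OF j]])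
    fix n
    have "A j (F n j) \<noteq> {}"
    proof
      assume "A j (F n j) = {}"
      then have "borel_separable J (\<lambda>j. A j (F n j))"
        unfolding borel_separable_def using j
        by (intro exI[of _ "\<lambda>i. if i = j then {} else UNIV"]) auto
      then show False using F(1) by blast
    qed
    then show "\<exists>x' z'. (x', z') \<in> C j \<and> prefix_of n x' = prefix_of n (x j) \<and>
        prefix_of n z' = prefix_of n (z j)"
      by (auto simp: A_def F(2) xz)
  qed
  then have x: "x j \<in> fst ` C j" if "j \<in> J" for j using that by force
  have "J \<noteq> {}" using empty by auto
  then obtain i where i: "i \<in> J" by blast
  obtain j where j: "j \<in> J" "x i \<noteq> x j"
    using x empty i by (metis (no_types, lifting) INT_I empty_iff)
  then obtain n where n: "x i n \<noteq> x j n" by auto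
  \<comment> \<open>Length \<open>Suc n\<close> makes the cylinders see the coordinate
    \<open>n\<close> at which the two limits differ.\<close>
  let ?S = "\<lambda>l. {y. prefix_of (Suc n) y = prefix_of (Suc n) (x l)}"
  have "A l (F (Suc n) l) \<subseteq> ?S l" for l
    by (auto simp: A_def F(2) xz)
  moreover have "?S i \<inter> ?S j = {}"
    using n by (auto simp: prefix_of_eq_iff)
  then have "(\<Inter>l\<in>J. ?S l) = {}" using i j(1) by blast
  ultimately have "borel_separable J (\<lambda>j. A j (F (Suc n) j))"
    unfolding borel_separable_def by (intro exI[of _ ?S]) (simp add: borel_prefix_of)
  then show False using F(1) by blast
qed

subsection \<open>Projections with finite fibres\<close>

lemma borel_fst_image:
  fixes E :: "((nat \<Rightarrow> nat) \<times> (nat \<Rightarrow> nat)) set"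
  assumes E: "E \<in> sets borel"
    and fin: "\<And>x. finite {y. (x, y) \<in> E}" and card: "\<And>x. card {y. (x, y) \<in> E} \<le> D"
  shows "fst ` E \<in> sets borel"
proof -
  obtain C0 :: "(((nat \<Rightarrow> nat) \<times> (nat \<Rightarrow> nat)) \<times> (nat \<Rightarrow> nat)) set"
    where C0: "closed C0" "fst ` C0 = E" "inj_on fst C0"
    using borel_unique_projection[OF E] unfolding unique_projection_def by blast
  \<comment> \<open>Even entries of a sequence code the second coordinate of \<open>E\<close>, odd
    entries the witness from \<open>C0\<close>; the projection of \<open>E\<close> becomes that of a
    closed set with a single Baire factor.\<close>
  define f where "f = (\<lambda>p :: (nat \<Rightarrow> nat) \<times> (nat \<Rightarrow> nat). ((fst p, \<lambda>n. snd p (2 * n)), \<lambda>n. snd p (Suc (2 * n))))"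
  have f: "continuous_on UNIV f"
    unfolding f_def
    by (intro continuous_on_Pair continuous_on_coordinatewise_then_product
        continuous_on_snd_coordinate continuous_on_fst continuous_on_id)
  have surj_f: "\<exists>z. f (x, z) = ((x, y), w)" for x y w
    by (rule exI[of _ "\<lambda>n. if even n then y (n div 2) else w (n div 2)"]) (simp add: f_def)
  have inj_f: "inj f"
  proof (rule injI)
    fix p q assume H: "f p = f q"
    then have "snd p (2 * n) = snd q (2 * n)" "snd p (Suc (2 * n)) = snd q (Suc (2 * n))" for n
      by (auto simp: f_def dest: fun_cong)
    then have "snd p n = snd q n" for n
      by (cases "even n") (auto elim!: evenE oddE)
    then show "p = q" using H by (auto simp: f_def prod_eq_iff)
  qed
  define C where "C = f -` C0"
  have C: "closed C" unfolding C_def by (rule closed_vimage[OF C0(1) f])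
  have fst_C: "fst ` C = fst ` E"
  proof (intro set_eqI iffI)
    fix x assume "x \<in> fst ` E"
    then obtain y where "(x, y) \<in> E" by auto
    then have "(x, y) \<in> fst ` C0" using C0(2) by simp
    then obtain w where w: "((x, y), w) \<in> C0" by auto
    obtain z where "f (x, z) = ((x, y), w)" using surj_f by blast
    then have "(x, z) \<in> C" using w by (simp add: C_def)
    then show "x \<in> fst ` C" by force
  next
    fix x assume "x \<in> fst ` C"
    then obtain z where "(x, z) \<in> C" by auto
    then have "f (x, z) \<in> C0" by (simp add: C_def)
    then have "fst (f (x, z)) \<in> E" using C0(2) by blast
    then show "x \<in> fst ` E" by (force simp: f_def)
  qed
  \<comment> \<open>The witness is determined by the pair in \<open>E\<close>, so the fibres do not
    grow and the bound \<open>D\<close> persists.\<close>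
  have fibre: "finite {z. (x, z) \<in> C} \<and> card {z. (x, z) \<in> C} \<le> D" for x
  proof -
    let ?h = "\<lambda>z. snd (fst (f (x, z)))"
    have inj: "inj_on ?h {z. (x, z) \<in> C}"
    proof (rule inj_onI)
      fix z z' assume "z \<in> {z. (x, z) \<in> C}" "z' \<in> {z. (x, z) \<in> C}" and eq: "?h z = ?h z'"
      then have "f (x, z) \<in> C0" "f (x, z') \<in> C0" by (auto simp: C_def)
      moreover have "fst (f (x, z)) = fst (f (x, z'))"
        using eq by (simp add: f_def)
      ultimately have "f (x, z) = f (x, z')" using C0(3) by (auto dest: inj_onD)
      then show "z = z'" using inj_f by (auto dest: injD)
    qed
    have sub: "?h ` {z. (x, z) \<in> C} \<subseteq> {y. (x, y) \<in> E}"
    proof clarify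
      fix z assume "(x, z) \<in> C"
      then have "fst (f (x, z)) \<in> E" using C0(2) by (auto simp: C_def)
      then show "(x, ?h z) \<in> E" by (simp add: f_def)
    qed
    show ?thesis
      using inj_on_finite[OF inj sub fin] card_inj_on_le[OF inj sub fin] card[of x] by simp
  qed
  define A where "A l = fst ` (C \<inter> snd -` {z. prefix_of (length l) z = l})" for l
  \<comment> \<open>\<open>D + 1\<close> words of one length belong to disjoint cylinders, so a
    point lying over all of them would have more than \<open>D\<close> points in its fibre.\<close>
  define \<J> :: "nat list set set" where "\<J> = {J. finite J \<and> card J = Suc D \<and> (\<exists>n. \<forall>l\<in>J. length l = n)}"
  have "borel_separable J A" if J: "J \<in> \<J>" for J
    unfolding A_def
  proof (rule borel_separable_analytic)
    show "finite J" using J by (simp add: \<J>_def)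
    show "closed (C \<inter> snd -` {z. prefix_of (length l) z = l})" for l
      by (intro closed_Int C closed_vimage closed_prefix_of continuous_on_snd continuous_on_id)
    show "(\<Inter>l\<in>J. fst ` (C \<inter> snd -` {z. prefix_of (length l) z = l})) = {}"
    proof (rule ccontr)
      assume "\<not> ?thesis"
      then obtain x where "\<forall>l\<in>J. \<exists>z. (x, z) \<in> C \<and> prefix_of (length l) z = l" by force
      then obtain Z where Z: "\<And>l. l \<in> J \<Longrightarrow> (x, Z l) \<in> C \<and> prefix_of (length l) (Z l) = l"
        by metis
      obtain n where n: "\<And>l. l \<in> J \<Longrightarrow> length l = n" using J by (auto simp: \<J>_def)
      have "inj_on Z J" using Z n by (metis inj_onI)
      then have "Suc D \<le> card {z. (x, z) \<in> C}"
        using J Z fibre[of x] by (auto simp: \<J>_def dest!: card_inj_on_le[of Z J "{z. (x, z) \<in> C}"])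
      then show False using fibre[of x] by simp
    qed
  qed
  then have "\<forall>J\<in>\<J>. \<exists>S. (\<forall>l\<in>J. S l \<in> sets borel \<and> A l \<subseteq> S l) \<and> (\<Inter>l\<in>J. S l) = {}"
    unfolding borel_separable_def by blast
  then obtain S where "\<forall>J\<in>\<J>. (\<forall>l\<in>J. S J l \<in> sets borel \<and> A l \<subseteq> S J l) \<and> (\<Inter>l\<in>J. S J l) = {}"
    unfolding bchoice_iff by blast
  then have S: "\<And>J l. J \<in> \<J> \<Longrightarrow> l \<in> J \<Longrightarrow> S J l \<in> sets borel"
    "\<And>J l. J \<in> \<J> \<Longrightarrow> l \<in> J \<Longrightarrow> A l \<subseteq> S J l" "\<And>J. J \<in> \<J> \<Longrightarrow> (\<Inter>l\<in>J. S J l) = {}"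
    by blast+
  \<comment> \<open>\<open>cl l\<close> thickens \<open>A l\<close> to the cylinders of depth
    \<open>length l\<close> that meet it; as the depth grows, membership yields better and better
    approximations by points of \<open>C\<close>.\<close>
  define cl where "cl l = (\<Union>x'\<in>A l. {x. prefix_of (length l) x = prefix_of (length l) x'})" for l
  define B0 where "B0 l = cl l \<inter> (\<Inter>J\<in>{J\<in>\<J>. l \<in> J}. S J l)" for l
  \<comment> \<open>Intersecting over all initial segments of \<open>l\<close> makes the words whose
    sets contain a given point a tree.\<close>
  define B where "B l = (\<Inter>j\<le>length l. B0 (take j l))" for l
  have "cl l \<in> sets borel" for l
    unfolding cl_def by (intro borel_open open_UN ballI open_prefix_of)
  moreover have "countable \<J>"
    by (rule countable_subset[OF _ countable_Collect_finite]) (auto simp: \<J>_def)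
  ultimately have "B0 l \<in> sets borel" for l
    unfolding B0_def using S(1) by (intro sets.Int sets.countable_INT'') (auto intro: countable_subset)
  then have B_borel: "B l \<in> sets borel" for l
    unfolding B_def by (intro sets.countable_INT') auto
  have B_subset: "B l \<subseteq> B0 l" for l
    unfolding B_def by (intro INF_lower2[of "length l"]) auto
  have "fst ` C = (\<Inter>n. \<Union>l\<in>{l. length l = n}. B l)"
  proof (intro set_eqI iffI INT_I)
    fix x n assume "x \<in> fst ` C"
    then obtain z where z: "(x, z) \<in> C" by auto
    then have xA: "x \<in> A (prefix_of j z)" for j by (force simp: A_def)
    have "x \<in> B0 (prefix_of j z)" for j
      using xA[of j] S(2) by (auto simp: B0_def cl_def)
    then have "x \<in> B (prefix_of n z)"
      by (auto simp: B_def take_prefix_of)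
    then show "x \<in> (\<Union>l\<in>{l. length l = n}. B l)" by (intro UN_I[of "prefix_of n z"]) auto
  next
    fix x assume x: "x \<in> (\<Inter>n. \<Union>l\<in>{l. length l = n}. B l)"
    define T where "T = {l. x \<in> B l}"
    have T_take: "take n l \<in> T" if "l \<in> T" for l n
      using that by (auto simp: T_def B_def min_def)
    have T_level: "\<exists>l\<in>T. length l = n" for n using x by (auto simp: T_def)
    have T_fin: "finite {l\<in>T. length l = n}" for n
    proof (rule ccontr)
      assume "infinite {l\<in>T. length l = n}"
      then obtain J where J: "finite J" "card J = Suc D" "J \<subseteq> {l\<in>T. length l = n}"
        using infinite_arbitrarily_large[of "{l\<in>T. length l = n}" "Suc D"] by blast
      then have "J \<in> \<J>" by (auto simp: \<J>_def intro!: exI[of _ n])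
      moreover have "x \<in> S J l" if "l \<in> J" for l
      proof -
        have "x \<in> B0 l" using J(3) that B_subset by (auto simp: T_def)
        then show ?thesis using \<open>J \<in> \<J>\<close> that by (auto simp: B0_def)
      qed
      ultimately show False using S(3)[of J] by blast
    qed
    \<comment> \<open>Koenig's lemma: keep \<open>l\<close> as long as infinitely many words of the
      tree extend it. The levels being finite, some one-letter extension inherits this.\<close>
    define ext where "ext n l = {l'\<in>T. n \<le> length l' \<and> take n l' = l}" for n l
    have "\<exists>g. \<forall>n. infinite (ext n (g n)) \<and> take n (g (Suc n)) = g n"
    proof (rule dependent_nat_choice)
      have "infinite T"
      proof
        assume "finite T"
        then obtain N where "\<And>l. l \<in> T \<Longrightarrow> length l < N"
          using finite_nat_bounded[of "length ` T"] by auto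
        then show False using T_level[of N] by auto
      qed
      then show "\<exists>l. infinite (ext 0 l)" by (intro exI[of _ "[]"]) (simp add: ext_def)
    next
      fix l n assume inf: "infinite (ext n l)"
      have "ext n l \<subseteq> {l'\<in>T. length l' = n} \<union> (\<Union>m\<in>{m\<in>T. length m = Suc n \<and> take n m = l}. ext (Suc n) m)"
      proof
        fix l' assume l': "l' \<in> ext n l"
        show "l' \<in> {l'\<in>T. length l' = n} \<union> (\<Union>m\<in>{m\<in>T. length m = Suc n \<and> take n m = l}. ext (Suc n) m)"
        proof (cases "length l' = n")
          case False
          then have "l' \<in> ext (Suc n) (take (Suc n) l')" "take (Suc n) l' \<in> T"
            "length (take (Suc n) l') = Suc n" "take n (take (Suc n) l') = l"
            using l' T_take[of l'] by (auto simp: ext_def min_def)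
          then show ?thesis by blast
        qed (use l' in \<open>auto simp: ext_def\<close>)
      qed
      with inf have "infinite ({l'\<in>T. length l' = n} \<union> (\<Union>m\<in>{m\<in>T. length m = Suc n \<and> take n m = l}. ext (Suc n) m))"
        using finite_subset by blast
      moreover have "finite {m\<in>T. length m = Suc n \<and> take n m = l}"
        by (rule finite_subset[OF _ T_fin[of "Suc n"]]) auto
      ultimately show "\<exists>m. infinite (ext (Suc n) m) \<and> take n m = l"
        using T_fin[of n] by auto
    qed
    then obtain g where g: "\<And>n. infinite (ext n (g n))" "\<And>n. take n (g (Suc n)) = g n"
      by blast
    have gT: "g n \<in> T" "length (g n) = n" for n
    proof -
      obtain l where "l \<in> ext n (g n)" using infinite_imp_nonempty[OF g(1)[of n]] by blast
      then have "l \<in> T" "n \<le> length l" "g n = take n l" by (auto simp: ext_def)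
      then show "g n \<in> T" "length (g n) = n" using T_take[of l n] by auto
    qed
    define z where "z n = g (Suc n) ! n" for n
    have gz: "g n = prefix_of n z" for n
    proof (induction n)
      case 0
      show ?case using gT(2)[of 0] by simp
    next
      case (Suc n)
      have "g (Suc n) = take n (g (Suc n)) @ [g (Suc n) ! n]"
        using gT(2)[of "Suc n"] by (metis lessI order.refl take_Suc_conv_app_nth take_all)
      then show ?case using g(2)[of n] Suc by (simp add: prefix_of_Suc z_def)
    qed
    \<comment> \<open>Membership in \<open>cl\<close> supplies, at every depth, a point of
      \<open>C\<close> that agrees with \<open>(x, z)\<close> that far, and \<open>C\<close> is
      closed.\<close>
    have "(x, z) \<in> C"
    proof (rule closed_prefix_ofD[OF C])
      fix n
      have "x \<in> B0 (g n)" using gT(1)[of n] B_subset by (auto simp: T_def)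
      then have "x \<in> cl (prefix_of n z)" using gT(2)[of n] by (simp add: B0_def gz)
      then show "\<exists>x' z'. (x', z') \<in> C \<and> prefix_of n x' = prefix_of n x \<and> prefix_of n z' = prefix_of n z"
        by (auto simp: cl_def A_def) metis
    qed
    then show "x \<in> fst ` C" by force
  qed
  also have "\<dots> \<in> sets borel"
    using B_borel by (intro sets.countable_INT') auto
  finally show ?thesis using fst_C by simp
qed

subsection \<open>Standard Borel spaces as retracts of Baire space\<close>

lemma borel_coordinates: "{s :: nat \<Rightarrow> nat. P (s m) (s n)} \<in> sets borel"
proof -
  have "open {s :: nat \<Rightarrow> nat. s i = a}" for i a
    using open_vimage[OF discrete_topology_class.open_discrete continuous_on_product_coordinates[of i], of "{a}"]
    by (simp add: vimage_def)
  moreover have "{s. P (s m) (s n)} = (\<Union>(a, b)\<in>{(a, b). P a b}. {s. s m = a} \<inter> {s. s n = b})"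
    by auto
  ultimately show ?thesis
    by (auto intro!: borel_open open_UN open_Int simp: case_prod_unfold)
qed

text \<open>A point is coded by indices into a countable dense set that approximate it at a
  geometric rate; decoding takes the limit. A Borel left inverse on codes is enough to transport
  Borel questions to Baire space.\<close>

lemma standard_borel_retract:
  assumes "standard_borel_space M" "space M \<noteq> {}"
  obtains \<phi> :: "'a \<Rightarrow> nat \<Rightarrow> nat" and \<psi> where "\<phi> \<in> M \<rightarrow>\<^sub>M borel" "\<psi> \<in> borel \<rightarrow>\<^sub>M M"
    "\<And>x. x \<in> space M \<Longrightarrow> \<psi> (\<phi> x) = x"
proof -
  obtain X where X: "completely_metrizable_space X" "second_countable X"
    "sets M = sigma_sets (topspace X) {U. openin X U}"
    using assms(1) unfolding standard_borel_space_def by blast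
  obtain S d where S: "Metric_space S d" "Metric_space.mcomplete S d" "X = Metric_space.mtopology S d"
    using X(1) unfolding completely_metrizable_space_def by blast
  interpret Metric_space S d by fact
  have sub: "{U. openin X U} \<subseteq> Pow (topspace X)" using openin_subset by blast
  have sets_M: "sets M = sigma_sets S {U. openin X U}" using X(3) S(3) by simp
  have space_M: "space M = S"
    using sets_eq_imp_space_eq[of M "sigma (topspace X) {U. openin X U}"] X(3) S(3) sub by simp
  obtain Q where Q: "countable Q" "Q \<subseteq> S" "mtopology closure_of Q = S"
    using second_countable_imp_separable_space[OF X(2)] S(3) by (auto simp: separable_space_def)
  have "Q \<noteq> {}" using Q(3) assms(2) space_M by auto
  define q where "q = from_nat_into Q"
  have qS: "q i \<in> S" for i using Q(2) from_nat_into[OF \<open>Q \<noteq> {}\<close>] by (auto simp: q_def)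
  have dense: "\<exists>i. d x (q i) < e" if "x \<in> S" "e > 0" for x e
  proof -
    from that Q(3) obtain y where "y \<in> Q" "y \<in> mball x e" by (auto simp: metric_closure_of)
    then show ?thesis using from_nat_into_surj[OF Q(1)] by (auto simp: q_def)
  qed
  \<comment> \<open>The exponent \<open>n + 2\<close> leaves room for the triangle inequality: two
    such errors add up to at most the tolerance \<open>(1/2)^m\<close> demanded by
    \<open>conv\<close>.\<close>
  define \<phi> where "\<phi> x n = (LEAST i. d x (q i) < (1/2)^(n+2))" for x n
  have \<phi>: "d x (q (\<phi> x n)) < (1/2)^(n+2)" if "x \<in> S" for x n
    unfolding \<phi>_def by (rule LeastI_ex) (rule dense[OF that], simp)
  have "\<phi> \<in> M \<rightarrow>\<^sub>M borel"
  proof (rule measurable_coordinatewise_then_product)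
    fix n
    have [measurable]: "Measurable.pred M (\<lambda>x. d x (q i) < e)" for i e
    proof -
      have "{x \<in> space M. d x (q i) < e} = mball (q i) e"
        using qS by (auto simp: space_M in_mball commute)
      moreover have "mball (q i) e \<in> sets M"
        unfolding sets_M S(3) by (rule sigma_sets.Basic) simp
      ultimately show ?thesis by (simp add: pred_def)
    qed
    have "(\<lambda>x. \<phi> x n) \<in> M \<rightarrow>\<^sub>M count_space UNIV" unfolding \<phi>_def by measurable
    then show "(\<lambda>x. \<phi> x n) \<in> borel_measurable M"
      using measurable_cong_sets[OF refl sets_borel_eq_count_space, of M] by blast
  qed
  define conv where "conv s \<longleftrightarrow> (\<forall>m n. m \<le> n \<longrightarrow> d (q (s m)) (q (s n)) \<le> (1/2)^m)" for s
  \<comment> \<open>Sequences violating \<open>conv\<close> are sent to the arbitrary point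
    \<open>q 0\<close>, which keeps \<open>\<psi>\<close> total with values in the space.\<close>
  define \<psi> where "\<psi> s = (if conv s then SOME l. limitin mtopology (\<lambda>n. q (s n)) l sequentially else q 0)" for s
  have lim: "limitin mtopology (\<lambda>n. q (s n)) (\<psi> s) sequentially" if s: "conv s" for s
  proof -
    have "MCauchy (\<lambda>n. q (s n))"
      unfolding MCauchy_def
    proof (intro conjI allI impI)
      fix e :: real assume "e > 0"
      then obtain N where N: "(1/2)^N < e" using real_arch_pow_inv[of e "1/2"] by auto
      have "d (q (s m)) (q (s n)) < e" if "N \<le> m" "N \<le> n" for m n
      proof -
        have pow: "(1/2::real)^k < e" if "N \<le> k" for k
          using N power_decreasing[OF that, of "1/2::real"] by linarith
        show ?thesis
        proof (cases "m \<le> n")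
          case True
          then show ?thesis using s pow[OF \<open>N \<le> m\<close>] unfolding conv_def by (meson le_less_trans)
        next
          case False
          then have "d (q (s n)) (q (s m)) \<le> (1/2)^n" using s unfolding conv_def by simp
          then show ?thesis using pow[OF \<open>N \<le> n\<close>] by (simp add: commute)
        qed
      qed
      then show "\<exists>N. \<forall>n n'. N \<le> n \<longrightarrow> N \<le> n' \<longrightarrow> d (q (s n)) (q (s n')) < e" by blast
    qed (use qS in auto)
    then have "\<exists>l. limitin mtopology (\<lambda>n. q (s n)) l sequentially"
      using S(2) unfolding mcomplete_def by blast
    then show ?thesis using s unfolding \<psi>_def by (auto intro: someI_ex)
  qed
  have \<psi>S: "\<psi> s \<in> S" for s
    using lim[of s] qS by (cases "conv s") (auto simp: \<psi>_def dest: limitin_mspace)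
  have lim_d: "\<exists>N. \<forall>n\<ge>N. d (q (s n)) (\<psi> s) < e" if "conv s" "e > 0" for s e
    using lim[OF that(1)] that(2) unfolding limitin_metric eventually_sequentially by blast
  have "\<psi> (\<phi> x) = x" if x: "x \<in> S" for x
  proof -
    have *: "d (q (\<phi> x n)) x < (1/2)^(n+2)" for n using \<phi>[OF x, of n] by (simp add: commute)
    have "conv (\<phi> x)"
      unfolding conv_def
    proof (intro allI impI)
      fix m n :: nat assume "m \<le> n"
      then have "(1/2::real)^(n+2) \<le> (1/2)^(m+2)" by (intro power_decreasing) auto
      moreover have "2 * (1/2::real)^(m+2) \<le> (1/2)^m" by simp
      ultimately show "d (q (\<phi> x m)) (q (\<phi> x n)) \<le> (1/2)^m"
        using *[of m] \<phi>[OF x, of n] triangle[OF qS[of "\<phi> x m"] x qS[of "\<phi> x n"]] by linarith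
    qed
    then have "limitin mtopology (\<lambda>n. q (\<phi> x n)) (\<psi> (\<phi> x)) sequentially" by (rule lim)
    moreover have "limitin mtopology (\<lambda>n. q (\<phi> x n)) x sequentially"
      unfolding limitin_metric eventually_sequentially
    proof (intro conjI allI impI)
      fix e :: real assume "e > 0"
      then obtain N where N: "(1/2)^N < e" using real_arch_pow_inv[of e "1/2"] by auto
      have "q (\<phi> x n) \<in> S \<and> d (q (\<phi> x n)) x < e" if "N \<le> n" for n
        using *[of n] N power_decreasing[of N "n+2" "1/2::real"] that qS by auto
      then show "\<exists>N. \<forall>n\<ge>N. q (\<phi> x n) \<in> S \<and> d (q (\<phi> x n)) x < e" by blast
    qed (use x in simp)
    ultimately show ?thesis using limitin_metric_unique by (metis trivial_limit_sequentially)
  qed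
  moreover have "\<psi> \<in> borel \<rightarrow>\<^sub>M M"
  proof (rule measurable_sigma_sets[OF sets_M])
    show "{U. openin X U} \<subseteq> Pow S" using sub S(3) by simp
    show "\<psi> \<in> space borel \<rightarrow> S" using \<psi>S by simp
    fix U assume "U \<in> {U. openin X U}"
    then have U: "openin mtopology U" using S(3) by simp
    have UNIV: "UNIV \<in> sets (borel :: (nat \<Rightarrow> nat) measure)"
      using sets.top[of borel] by (simp only: space_borel)
    have cauchy: "{s. m \<le> n \<longrightarrow> d (q (s m)) (q (s n)) \<le> (1/2)^m} \<in> sets borel" for m n :: nat
      by (rule borel_coordinates)
    have conv_eq: "{s. conv s} = (\<Inter>m. \<Inter>n. {s. m \<le> n \<longrightarrow> d (q (s m)) (q (s n)) \<le> (1/2)^m})"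
      by (auto simp: conv_def)
    have conv_borel: "{s. conv s} \<in> sets borel"
      unfolding conv_eq by (intro sets.countable_INT'' UNIV countableI_type cauchy)
    have near: "{s. conv s \<and> (\<exists>N. \<forall>n\<ge>N. d (q (s n)) (q i) < e)} \<in> sets borel" for i e
    proof -
      have eq: "{s. conv s \<and> (\<exists>N. \<forall>n\<ge>N. d (q (s n)) (q i) < e)}
          = {s. conv s} \<inter> (\<Union>N. \<Inter>n. {s. N \<le> n \<longrightarrow> d (q (s n)) (q i) < e})"
        by auto
      have tail: "{s. N \<le> n \<longrightarrow> d (q (s n)) (q i) < e} \<in> sets borel" for N n :: nat
        by (rule borel_coordinates[of "\<lambda>a b. N \<le> n \<longrightarrow> d (q a) (q i) < e" n n])
      show ?thesis
        unfolding eq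
        by (intro sets.Int conv_borel sets.countable_UN'' sets.countable_INT'' UNIV countableI_type tail)
    qed
    \<comment> \<open>An open set is tested through closed balls inside it: being eventually close
      to \<open>q i\<close> is a countable condition on the code, and the limit then stays in the
      closed ball.\<close>
    define W where "W = {(i, k). mcball (q i) (1 / Suc k) \<subseteq> U}"
    have "\<psi> -` U \<inter> space borel = (\<Union>(i, k)\<in>W. {s. conv s \<and> (\<exists>N. \<forall>n\<ge>N. d (q (s n)) (q i) < 1 / Suc k)})
        \<union> (if q 0 \<in> U then {s. \<not> conv s} else {})" (is "_ = ?R")
    proof (intro set_eqI iffI)
      fix s assume "s \<in> \<psi> -` U \<inter> space borel"
      then have sU: "\<psi> s \<in> U" by simp
      show "s \<in> ?R"
      proof (cases "conv s")
        case True
        obtain r where r: "r > 0" "mball (\<psi> s) r \<subseteq> U" using U sU by (auto simp: openin_mtopology)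
        obtain k where k: "1 / Suc k < r / 2" using r(1) nat_approx_posE[of "r/2"] by auto
        obtain i where i: "d (\<psi> s) (q i) < 1 / Suc k" using dense[OF \<psi>S, of "1 / Suc k"] by auto
        have "mcball (q i) (1 / Suc k) \<subseteq> mball (\<psi> s) r"
        proof
          fix y assume "y \<in> mcball (q i) (1 / Suc k)"
          then have y: "y \<in> S" "d (q i) y \<le> 1 / Suc k" by auto
          have "d (\<psi> s) y \<le> d (\<psi> s) (q i) + d (q i) y" using triangle \<psi>S qS y by blast
          then show "y \<in> mball (\<psi> s) r" using y i k \<psi>S by auto
        qed
        then have "(i, k) \<in> W" using r(2) by (auto simp: W_def)
        moreover have "\<exists>N. \<forall>n\<ge>N. d (q (s n)) (q i) < 1 / Suc k"
        proof -
          obtain N where N: "\<And>n. n \<ge> N \<Longrightarrow> d (q (s n)) (\<psi> s) < 1 / Suc k - d (\<psi> s) (q i)"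
            using lim_d[OF True, of "1 / Suc k - d (\<psi> s) (q i)"] i by auto
          have "d (q (s n)) (q i) < 1 / Suc k" if "n \<ge> N" for n
            using N[OF that] triangle[OF qS[of "s n"] \<psi>S[of s] qS[of i]] by linarith
          then show ?thesis by blast
        qed
        ultimately show ?thesis using True by blast
      next
        case False
        then show ?thesis using sU by (simp add: \<psi>_def)
      qed
    next
      fix s assume "s \<in> ?R"
      then consider i k N where "(i, k) \<in> W" "conv s" "\<And>n. n \<ge> N \<Longrightarrow> d (q (s n)) (q i) < 1 / Suc k"
        | "q 0 \<in> U" "\<not> conv s"
        by (auto split: if_splits)
      then show "s \<in> \<psi> -` U \<inter> space borel"
      proof cases
        case 1
        have "d (q i) (\<psi> s) \<le> 1 / Suc k"
        proof (rule field_le_epsilon)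
          fix e :: real assume "e > 0"
          then obtain N' where N': "\<And>n. n \<ge> N' \<Longrightarrow> d (q (s n)) (\<psi> s) < e"
            using lim_d[OF 1(2)] by blast
          show "d (q i) (\<psi> s) \<le> 1 / Suc k + e"
            using N'[of "max N N'"] 1(3)[of "max N N'"]
              triangle[OF qS[of i] qS[of "s (max N N')"] \<psi>S[of s]]
            by (simp add: commute)
        qed
        then have "\<psi> s \<in> mcball (q i) (1 / Suc k)" using qS \<psi>S by simp
        then show ?thesis using 1(1) by (auto simp: W_def)
      qed (simp add: \<psi>_def)
    qed
    moreover have "{s. \<not> conv s} \<in> sets borel"
      using borel_comp[OF conv_borel] by (simp add: Compl_eq)
    ultimately show "\<psi> -` U \<inter> space borel \<in> sets borel"
      using near by (auto intro!: sets.Un sets.countable_UN')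
  qed
  ultimately show thesis
    using that[of \<phi> \<psi>] \<open>\<phi> \<in> M \<rightarrow>\<^sub>M borel\<close> space_M by blast
qed

section \<open>Projection and uniformization in standard Borel spaces\<close>

lemma borel_measurable_equality_set_fun:
  fixes f g :: "'a \<Rightarrow> nat \<Rightarrow> nat"
  assumes "f \<in> borel_measurable N" "g \<in> borel_measurable N"
  shows "{x \<in> space N. f x = g x} \<in> sets N"
proof -
  have "{x \<in> space N. f x = g x} = space N \<inter> (\<Inter>n. {x \<in> space N. f x n = g x n})" by auto
  moreover have "{x \<in> space N. f x n = g x n} \<in> sets N" for n
    by (intro measurable_equality_set measurable_compose[OF assms(1) measurable_product_coordinates]
        measurable_compose[OF assms(2) measurable_product_coordinates])
  ultimately show ?thesis by (auto intro!: sets.Int sets.countable_INT')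
qed

text \<open>The image of \<open>\<phi>\<close> is the Borel set of fixed points of
  \<open>\<phi> \<circ> \<psi>\<close>, so \<open>E\<close> can be moved into Baire space with the
  same fibre bound, projected there, and pulled back.\<close>

lemma borel_projection:
  assumes M: "standard_borel_space M" and E: "E \<in> sets (M \<Otimes>\<^sub>M M)"
    and fin: "\<And>x. x \<in> space M \<Longrightarrow> finite {y. (x, y) \<in> E}"
    and card: "\<And>x. x \<in> space M \<Longrightarrow> card {y. (x, y) \<in> E} \<le> D"
  shows "{x \<in> space M. \<exists>y. (x, y) \<in> E} \<in> sets M"
proof (cases "space M = {}")
  case True
  then show ?thesis by simp
next
  case False
  obtain \<phi> :: "'a \<Rightarrow> nat \<Rightarrow> nat" and \<psi> where \<phi>: "\<phi> \<in> M \<rightarrow>\<^sub>M borel" and \<psi>: "\<psi> \<in> borel \<rightarrow>\<^sub>M M"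
    and \<psi>\<phi>: "\<And>x. x \<in> space M \<Longrightarrow> \<psi> (\<phi> x) = x"
    using standard_borel_retract[OF M False] by blast
  have E_sub: "(x, y) \<in> E \<Longrightarrow> x \<in> space M \<and> y \<in> space M" for x y
    using sets.sets_into_space[OF E] by (auto simp: space_pair_measure)
  let ?B = "borel :: ((nat \<Rightarrow> nat) \<times> (nat \<Rightarrow> nat)) measure"
  have 1: "fst \<in> ?B \<rightarrow>\<^sub>M borel" "snd \<in> ?B \<rightarrow>\<^sub>M borel"
    by (simp_all add: borel_prod[symmetric])
  have 2: "(\<lambda>p. (\<psi> (fst p), \<psi> (snd p))) \<in> ?B \<rightarrow>\<^sub>M M \<Otimes>\<^sub>M M"
    by (intro measurable_Pair measurable_compose[OF 1(1) \<psi>] measurable_compose[OF 1(2) \<psi>])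
  have 3: "(\<lambda>p. \<phi> (\<psi> (fst p))) \<in> ?B \<rightarrow>\<^sub>M borel" "(\<lambda>p. \<phi> (\<psi> (snd p))) \<in> ?B \<rightarrow>\<^sub>M borel"
    by (intro measurable_compose[OF _ \<phi>] measurable_compose[OF 1(1) \<psi>] measurable_compose[OF 1(2) \<psi>])+
  define E' where "E' = ((\<lambda>p. (\<psi> (fst p), \<psi> (snd p))) -` E \<inter> space ?B)
    \<inter> ({p \<in> space ?B. \<phi> (\<psi> (fst p)) = fst p} \<inter> {p \<in> space ?B. \<phi> (\<psi> (snd p)) = snd p})"
  have E': "E' \<in> sets borel"
    unfolding E'_def
    by (rule sets.Int[OF measurable_sets[OF 2 E] sets.Int[OF
        borel_measurable_equality_set_fun[OF 3(1) 1(1)] borel_measurable_equality_set_fun[OF 3(2) 1(2)]]])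
  have E'_iff: "(\<phi> x, c) \<in> E' \<longleftrightarrow> c \<in> \<phi> ` {y. (x, y) \<in> E}" if "x \<in> space M" for x c
    using E_sub \<psi>\<phi> that by (auto simp: E'_def image_iff)
  have fibre: "finite {d. (c, d) \<in> E'} \<and> card {d. (c, d) \<in> E'} \<le> D" for c
  proof (cases "c \<in> \<phi> ` space M")
    case True
    then obtain x where x: "x \<in> space M" "c = \<phi> x" by blast
    then have "{d. (c, d) \<in> E'} = \<phi> ` {y. (x, y) \<in> E}" using E'_iff by auto
    then show ?thesis using fin[OF x(1)] card[OF x(1)] card_image_le[OF fin[OF x(1)], of \<phi>] by auto
  next
    case False
    then have "{d. (c, d) \<in> E'} = {}" using measurable_space[OF \<psi>, of c] by (auto simp: E'_def) (metis imageI)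
    then show ?thesis by simp
  qed
  have "fst ` E' \<in> sets borel"
    by (rule borel_fst_image[OF E']) (use fibre in auto)
  then have "\<phi> -` (fst ` E') \<inter> space M \<in> sets M" by (rule measurable_sets[OF \<phi>])
  also have "\<phi> -` (fst ` E') \<inter> space M = {x \<in> space M. \<exists>y. (x, y) \<in> E}"
  proof (intro set_eqI iffI)
    fix x assume "x \<in> \<phi> -` (fst ` E') \<inter> space M"
    then obtain c where "(\<phi> x, c) \<in> E'" "x \<in> space M" by auto
    then show "x \<in> {x \<in> space M. \<exists>y. (x, y) \<in> E}" using E'_iff by auto
  next
    fix x assume "x \<in> {x \<in> space M. \<exists>y. (x, y) \<in> E}"
    then obtain y where "x \<in> space M" "(x, y) \<in> E" by blast
    then have "(\<phi> x, \<phi> y) \<in> E'" using E'_iff by auto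
    then show "x \<in> \<phi> -` (fst ` E') \<inter> space M" using \<open>x \<in> space M\<close> by force
  qed
  finally show ?thesis .
qed

lemma standard_borel_equality_set:
  assumes "standard_borel_space M" "f \<in> N \<rightarrow>\<^sub>M M" "g \<in> N \<rightarrow>\<^sub>M M"
  shows "{x \<in> space N. f x = g x} \<in> sets N"
proof (cases "space M = {}")
  case True
  then have "space N = {}" using measurable_space[OF assms(2)] by auto
  then show ?thesis by simp
next
  case False
  obtain \<phi> :: "'a \<Rightarrow> nat \<Rightarrow> nat" and \<psi> where \<phi>: "\<phi> \<in> M \<rightarrow>\<^sub>M borel" and \<psi>: "\<psi> \<in> borel \<rightarrow>\<^sub>M M"
    and \<psi>\<phi>: "\<And>x. x \<in> space M \<Longrightarrow> \<psi> (\<phi> x) = x"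
    using standard_borel_retract[OF assms(1) False] by blast
  have "{x \<in> space N. \<phi> (f x) = \<phi> (g x)} \<in> sets N"
    by (intro borel_measurable_equality_set_fun measurable_compose[OF _ \<phi>] assms)
  also have "{x \<in> space N. \<phi> (f x) = \<phi> (g x)} = {x \<in> space N. f x = g x}"
    using \<psi>\<phi> measurable_space[OF assms(2)] measurable_space[OF assms(3)] by (auto, metis)
  finally show ?thesis .
qed

text \<open>Distinct points have distinct codes, so a long enough initial segment of a code isolates
  its point from finitely many others, and there are only countably many finite words.\<close>

lemma standard_borel_separating_sequence:
  assumes M: "standard_borel_space M"
  obtains V :: "nat \<Rightarrow> 'a set" where "\<And>n. V n \<in> sets M"
    "\<And>F y. finite F \<Longrightarrow> F \<subseteq> space M \<Longrightarrow> y \<in> F \<Longrightarrow> \<exists>n. V n \<inter> F = {y}"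
proof (cases "space M = {}")
  case True
  then show thesis by (intro that[of "\<lambda>_. {}"]) auto
next
  case False
  obtain \<phi> :: "'a \<Rightarrow> nat \<Rightarrow> nat" and \<psi> where \<phi>: "\<phi> \<in> M \<rightarrow>\<^sub>M borel" and \<psi>: "\<psi> \<in> borel \<rightarrow>\<^sub>M M"
    and \<psi>\<phi>: "\<And>x. x \<in> space M \<Longrightarrow> \<psi> (\<phi> x) = x"
    using standard_borel_retract[OF M False] by blast
  define V where "V n = \<phi> -` {s. prefix_of (length (from_nat n :: nat list)) s = from_nat n} \<inter> space M" for n
  show thesis
  proof (rule that[of V])
    show "V n \<in> sets M" for n
      unfolding V_def by (intro measurable_sets[OF \<phi>] borel_prefix_of)
    fix F y assume F: "finite F" "F \<subseteq> space M" "y \<in> F"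
    have "\<exists>m. \<phi> z m \<noteq> \<phi> y m" if "z \<in> F - {y}" for z
    proof -
      have "\<phi> z \<noteq> \<phi> y" using that F \<psi>\<phi> by (metis DiffE insertCI subsetD)
      then show ?thesis by auto
    qed
    then obtain m where m: "\<And>z. z \<in> F - {y} \<Longrightarrow> \<phi> z (m z) \<noteq> \<phi> y (m z)" by metis
    have "finite (m ` (F - {y}))" using F(1) by simp
    then obtain N where N: "\<And>z. z \<in> F - {y} \<Longrightarrow> m z < N"
      using finite_nat_bounded[of "m ` (F - {y})"] by auto
    have "prefix_of N (\<phi> z) \<noteq> prefix_of N (\<phi> y)" if "z \<in> F - {y}" for z
      using m[OF that] N[OF that] by (auto simp: prefix_of_eq_iff)
    then have "V (to_nat (prefix_of N (\<phi> y))) \<inter> F = {y}"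
      using F by (auto simp: V_def)
    then show "\<exists>n. V n \<inter> F = {y}" by blast
  qed
qed

text \<open>Each point of a finite fibre is alone in some \<open>V n\<close>. Selecting the member
  of the fibre that lies in \<open>V n\<close>, wherever there is exactly one, therefore enumerates
  the whole fibre.\<close>

lemma borel_uniformization:
  assumes M: "standard_borel_space M" and E: "E \<in> sets (M \<Otimes>\<^sub>M M)"
    and fin: "\<And>x. x \<in> space M \<Longrightarrow> finite {y. (x, y) \<in> E}"
    and card: "\<And>x. x \<in> space M \<Longrightarrow> card {y. (x, y) \<in> E} \<le> D"
  obtains g :: "nat \<Rightarrow> 'a \<Rightarrow> 'a" and U where "\<And>n. g n \<in> M \<rightarrow>\<^sub>M M" "\<And>n. U n \<in> sets M"
    "\<And>x. x \<in> space M \<Longrightarrow> {y. (x, y) \<in> E} = {g n x | n. x \<in> U n}"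
proof -
  obtain V :: "nat \<Rightarrow> 'a set" where V: "\<And>n. V n \<in> sets M"
    "\<And>F y. finite F \<Longrightarrow> F \<subseteq> space M \<Longrightarrow> y \<in> F \<Longrightarrow> \<exists>n. V n \<inter> F = {y}"
    by (rule standard_borel_separating_sequence[OF M]) blast
  have E_sub: "(x, y) \<in> E \<Longrightarrow> x \<in> space M \<and> y \<in> space M" for x y
    using sets.sets_into_space[OF E] by (auto simp: space_pair_measure)
  define P where "P B = {x \<in> space M. \<exists>y\<in>B. (x, y) \<in> E}" for B
  have P: "P B \<in> sets M" if B: "B \<in> sets M" for B
  proof -
    have "{x \<in> space M. \<exists>y. (x, y) \<in> E \<inter> space M \<times> B} \<in> sets M"
    proof (rule borel_projection[OF M])
      show "E \<inter> space M \<times> B \<in> sets (M \<Otimes>\<^sub>M M)" using E B by auto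
      fix x assume x: "x \<in> space M"
      have "{y. (x, y) \<in> E \<inter> space M \<times> B} \<subseteq> {y. (x, y) \<in> E}" by auto
      then show "finite {y. (x, y) \<in> E \<inter> space M \<times> B}" "card {y. (x, y) \<in> E \<inter> space M \<times> B} \<le> D"
        using finite_subset[OF _ fin[OF x]] order_trans[OF card_mono[OF fin[OF x]] card[OF x]] by blast+
    qed
    also have "{x \<in> space M. \<exists>y. (x, y) \<in> E \<inter> space M \<times> B} = P B" by (auto simp: P_def)
    finally show ?thesis .
  qed
  define U where "U n = {x \<in> space M. \<exists>!y. y \<in> V n \<and> (x, y) \<in> E}" for n
  \<comment> \<open>Non-uniqueness is a countable condition: two points of the fibre in
    \<open>V n\<close> are told apart by some \<open>V m\<close>, leaving a point on either
    side.\<close>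
  have U_eq: "U n = P (V n) - (\<Union>m. P (V n \<inter> V m) \<inter> P (V n - V m))" for n
  proof (intro set_eqI iffI)
    fix x assume "x \<in> U n"
    then show "x \<in> P (V n) - (\<Union>m. P (V n \<inter> V m) \<inter> P (V n - V m))"
      by (auto simp: U_def P_def)
  next
    fix x assume x: "x \<in> P (V n) - (\<Union>m. P (V n \<inter> V m) \<inter> P (V n - V m))"
    then obtain y where y: "x \<in> space M" "y \<in> V n" "(x, y) \<in> E" by (auto simp: P_def)
    have "z = y" if z: "z \<in> V n" "(x, z) \<in> E" for z
    proof (rule ccontr)
      assume "z \<noteq> y"
      moreover obtain m where "V m \<inter> {y, z} = {y}"
        using V(2)[of "{y, z}" y] E_sub[OF y(3)] E_sub[OF z(2)] by auto
      ultimately have "y \<in> V m" "z \<notin> V m" by auto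
      then have "x \<in> P (V n \<inter> V m) \<inter> P (V n - V m)" using y z by (auto simp: P_def)
      then show False using x by blast
    qed
    then show "x \<in> U n" using y by (auto simp: U_def)
  qed
  have U: "U n \<in> sets M" for n
    unfolding U_eq using V(1) by (intro sets.Diff sets.countable_UN'' sets.Int P countableI_type)
  \<comment> \<open>The default value \<open>x\<close> makes \<open>g n\<close> a total map of the
    space into itself.\<close>
  define g where "g n x = (if x \<in> U n then THE y. y \<in> V n \<and> (x, y) \<in> E else x)" for n x
  have gU: "g n x \<in> V n \<and> (x, g n x) \<in> E" if "x \<in> U n" for n x
    using that theI'[of "\<lambda>y. y \<in> V n \<and> (x, y) \<in> E"] by (simp add: g_def U_def)
  have gU_eq: "g n x = y" if "x \<in> U n" "y \<in> V n" "(x, y) \<in> E" for n x y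
    using that gU[OF that(1)] by (auto simp: U_def)
  show thesis
  proof (rule that[of g U])
    show "U n \<in> sets M" for n by (rule U)
    show "g n \<in> M \<rightarrow>\<^sub>M M" for n
    proof (rule measurableI)
      fix x assume "x \<in> space M"
      then show "g n x \<in> space M" using gU[of x n] E_sub by (auto simp: g_def)
    next
      fix B assume B: "B \<in> sets M"
      have "g n -` B \<inter> space M = (U n \<inter> P (V n \<inter> B)) \<union> (B - U n)"
      proof (intro set_eqI iffI)
        fix x assume "x \<in> g n -` B \<inter> space M"
        then show "x \<in> (U n \<inter> P (V n \<inter> B)) \<union> (B - U n)"
          using gU[of x n] by (cases "x \<in> U n") (auto simp: P_def g_def)
      next
        fix x assume "x \<in> (U n \<inter> P (V n \<inter> B)) \<union> (B - U n)"
        then show "x \<in> g n -` B \<inter> space M"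
          using gU_eq[of x n] sets.sets_into_space[OF B] by (auto simp: P_def g_def)
      qed
      also have "\<dots> \<in> sets M"
        by (intro sets.Un sets.Int sets.Diff U P V B)
      finally show "g n -` B \<inter> space M \<in> sets M" .
    qed
    fix x assume x: "x \<in> space M"
    show "{y. (x, y) \<in> E} = {g n x | n. x \<in> U n}"
    proof (intro set_eqI iffI)
      fix y assume y: "y \<in> {y. (x, y) \<in> E}"
      obtain n where n: "V n \<inter> {y. (x, y) \<in> E} = {y}"
        using V(2)[OF fin[OF x] _ y] E_sub by auto
      then have "z \<in> V n \<and> (x, z) \<in> E \<longleftrightarrow> z = y" for z by blast
      then have "x \<in> U n" using x by (simp add: U_def)
      moreover have "g n x = y" using n by (intro gU_eq \<open>x \<in> U n\<close>) auto
      ultimately show "y \<in> {g n x | n. x \<in> U n}" by blast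
    qed (use gU in auto)
  qed
qed

subsection \<open>The space of connected sets of a graphing\<close>

context graphing
begin

lemma edge_in_space: "(x, y) \<in> E \<Longrightarrow> x \<in> space M" "(x, y) \<in> E \<Longrightarrow> y \<in> space M"
  using sets.sets_into_space[OF edges_borel] by (auto simp: space_pair_measure)

lemma nbrs_in_space: "nbrs_in E (space M) x = {y. (x, y) \<in> E}"
  using edge_in_space by (auto simp: nbrs_in_def)

lemma finite_out_edges: "finite {y. (x, y) \<in> E}"
proof (cases "x \<in> space M")
  case True
  then show ?thesis using finite_nbrs by (simp add: nbrs_in_space)
next
  case False
  then have "{y. (x, y) \<in> E} = {}" using edge_in_space by blast
  then show ?thesis by simp
qed

lemma card_out_edges: "card {y. (x, y) \<in> E} \<le> D"
proof (cases "x \<in> space M")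
  case True
  then show ?thesis using deg_bound by (simp add: deg_in_def nbrs_in_space)
next
  case False
  then have "{y. (x, y) \<in> E} = {}" using edge_in_space by blast
  then show ?thesis by simp
qed

lemma edge_functions:
  obtains g :: "nat \<Rightarrow> 'a \<Rightarrow> 'a" and U where "\<And>n. g n \<in> M \<rightarrow>\<^sub>M M" "\<And>n. U n \<in> sets M"
    "\<And>x. x \<in> space M \<Longrightarrow> {y. (x, y) \<in> E} = {g n x | n. x \<in> U n}"
  by (rule borel_uniformization[OF standard_borel edges_borel finite_out_edges card_out_edges]) blast

lemma measurable_equality:
  "f \<in> N \<rightarrow>\<^sub>M M \<Longrightarrow> g \<in> N \<rightarrow>\<^sub>M M \<Longrightarrow> {x \<in> space N. f x = g x} \<in> sets N"
  by (rule standard_borel_equality_set[OF standard_borel])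

lemma measurable_degree: "(\<lambda>x. card {y. (x, y) \<in> E}) \<in> M \<rightarrow>\<^sub>M count_space UNIV"
proof -
  obtain g :: "nat \<Rightarrow> 'a \<Rightarrow> 'a" and U where g: "\<And>n. g n \<in> M \<rightarrow>\<^sub>M M" and U: "\<And>n. U n \<in> sets M"
    and gU: "\<And>x. x \<in> space M \<Longrightarrow> {y. (x, y) \<in> E} = {g n x | n. x \<in> U n}"
    by (rule edge_functions) blast
  \<comment> \<open>The edge functions may list a neighbour repeatedly; \<open>S x\<close> keeps the
    first index of each, so its cardinality is the degree.\<close>
  define S where "S x = {n. x \<in> U n \<and> (\<forall>m<n. \<not> (x \<in> U m \<and> g m x = g n x))}" for x
  have "{x \<in> space M. n \<in> S x} = U n - (\<Union>m\<in>{..<n}. U m \<inter> {x \<in> space M. g m x = g n x})" for n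
    using sets.sets_into_space[OF U] by (auto simp: S_def)
  then have "{x \<in> space M. n \<in> S x} \<in> sets M" for n
    by (auto intro!: sets.Diff sets.finite_UN sets.Int U measurable_equality g)
  then have "(\<lambda>x. card (S x)) \<in> M \<rightarrow>\<^sub>M count_space UNIV" by (rule measurable_card)
  also have "(\<lambda>x. card (S x)) \<in> M \<rightarrow>\<^sub>M count_space UNIV
      \<longleftrightarrow> (\<lambda>x. card {y. (x, y) \<in> E}) \<in> M \<rightarrow>\<^sub>M count_space UNIV"
  proof (rule measurable_cong)
    fix x assume x: "x \<in> space M"
    have "inj_on (\<lambda>n. g n x) (S x)"
      by (rule inj_onI) (metis (mono_tags, lifting) S_def mem_Collect_eq nat_neq_iff)
    moreover have "(\<lambda>n. g n x) ` S x = {y. (x, y) \<in> E}"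
    proof (intro set_eqI iffI)
      fix y assume "y \<in> {y. (x, y) \<in> E}"
      then obtain n where "x \<in> U n" "g n x = y" using gU[OF x] by auto
      then have "\<exists>n. x \<in> U n \<and> g n x = y" by blast
      define m where "m = (LEAST n. x \<in> U n \<and> g n x = y)"
      have m: "x \<in> U m \<and> g m x = y" unfolding m_def by (rule LeastI_ex) fact
      have "m \<in> S x"
        using m not_less_Least[of _ "\<lambda>n. x \<in> U n \<and> g n x = y"] by (auto simp: S_def m_def[symmetric])
      then show "y \<in> (\<lambda>n. g n x) ` S x" using m by auto
    next
      fix y assume "y \<in> (\<lambda>n. g n x) ` S x"
      then show "y \<in> {y. (x, y) \<in> E}" using gU[OF x] by (auto simp: S_def)
    qed
    ultimately show "card (S x) = card {y. (x, y) \<in> E}" by (metis card_image)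
  qed
  finally show ?thesis .
qed

text \<open>Membership in the union asks for an unknown set \<open>Y\<close> through
  \<open>x\<close>. Connectedness makes every point of \<open>Y\<close> the value at
  \<open>x\<close> of a word in countably many Borel maps, so the search runs over countably many
  tuples of words.\<close>

lemma Union_listings_measurable:
  assumes F: "F \<subseteq> conn_sets M E k" and meas: "\<And>m. listings M m F \<in> sets (\<Pi>\<^sub>M i\<in>{..<m}. M)"
  shows "\<Union>F \<in> sets M"
proof -
  obtain g :: "nat \<Rightarrow> 'a \<Rightarrow> 'a" and U where g: "\<And>n. g n \<in> M \<rightarrow>\<^sub>M M" and U: "\<And>n. U n \<in> sets M"
    and gU: "\<And>x. x \<in> space M \<Longrightarrow> {y. (x, y) \<in> E} = {g n x | n. x \<in> U n}"
    by (rule edge_functions) blast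
  have word: "fold g w \<in> M \<rightarrow>\<^sub>M M" for w
  proof (induction w)
    case (Cons n w)
    show ?case using measurable_comp[OF g[of n] Cons.IH] by (simp add: comp_def)
  qed (simp add: id_def)
  have reach: "\<exists>w. y = fold g w x" if "(x, y) \<in> (E \<inter> Y \<times> Y)\<^sup>*" for x y Y
    using that
  proof (induction rule: rtrancl_induct)
    case base
    show ?case by (rule exI[of _ "[]"]) simp
  next
    case (step y z)
    then obtain w where w: "y = fold g w x" by blast
    have "y \<in> space M" "(y, z) \<in> E" using step(2) edge_in_space by auto
    then obtain n where "z = g n y" using gU by blast
    then show ?case using w by (intro exI[of _ "w @ [n]"]) simp
  qed
  define L where "L ws = (\<lambda>x. \<lambda>i\<in>{..<length ws}. fold g (ws ! i) x)" for ws
  have L: "L ws \<in> M \<rightarrow>\<^sub>M (\<Pi>\<^sub>M i\<in>{..<length ws}. M)" for ws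
    unfolding L_def by (intro measurable_restrict word)
  have "\<Union>F = (\<Union>ws\<in>{ws. [] \<in> set ws}. L ws -` listings M (length ws) F \<inter> space M)" (is "_ = ?R")
  proof (intro set_eqI iffI)
    fix x assume "x \<in> \<Union>F"
    then obtain Y where Y: "Y \<in> F" "x \<in> Y" by blast
    then have YR: "Y \<in> conn_sets M E k" using F by blast
    then have fin: "finite Y" and sub: "Y \<subseteq> space M"
      by (auto simp: conn_sets_def intro: card_ge_0_finite)
    obtain e where e: "bij_betw e {0..<card Y} Y" using ex_bij_betw_nat_finite[OF fin] by blast
    \<comment> \<open>Giving \<open>x\<close> itself the empty word puts \<open>[]\<close> into the
      tuple; in the converse direction this is what places \<open>x\<close> in the listed
      set.\<close>
    have "\<exists>w. y = fold g w x \<and> (y = x \<longrightarrow> w = [])" if "y \<in> Y" for y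
    proof (cases "y = x")
      case False
      then show ?thesis using reach[of x y Y] YR Y that by (auto simp: conn_sets_def induces_connected_def)
    qed auto
    then obtain W where W: "\<And>y. y \<in> Y \<Longrightarrow> y = fold g (W y) x" "W x = []"
      using Y(2) by metis
    define ws where "ws = map (\<lambda>i. W (e i)) [0..<card Y]"
    obtain i where i: "i < card Y" "e i = x"
      using e Y(2) unfolding bij_betw_def by (metis atLeastLessThan_iff image_iff)
    have eY: "e i \<in> Y" if "i < card Y" for i using e that by (auto simp: bij_betw_def)
    have nil: "[] \<in> set ws" using i W(2) by (auto simp: ws_def image_iff intro!: bexI[of _ i])
    have Lx: "L ws x = restrict e {..<card Y}"
      using W(1)[OF eY] by (auto simp: L_def ws_def restrict_def fun_eq_iff)
    have len: "length ws = card Y" by (simp add: ws_def)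
    have "restrict e {..<card Y} ` {..<card Y} = Y" "inj_on (restrict e {..<card Y}) {..<card Y}"
      using e by (auto simp: bij_betw_def lessThan_atLeast0 inj_on_def)
    moreover have "restrict e {..<card Y} \<in> space (\<Pi>\<^sub>M i\<in>{..<card Y}. M)"
      using sub eY by (auto simp: space_PiM)
    ultimately have "L ws x \<in> listings M (length ws) F"
      unfolding Lx len listings_def using Y(1) by simp
    then show "x \<in> ?R" using Y(2) sub nil by blast
  next
    fix x assume "x \<in> ?R"
    then obtain ws where ws: "[] \<in> set ws" "L ws x ` {..<length ws} \<in> F" by (auto simp: listings_def)
    obtain i where "i < length ws" "ws ! i = []" using ws(1) by (metis in_set_conv_nth)
    then have "x \<in> L ws x ` {..<length ws}" by (auto simp: L_def image_iff intro!: bexI[of _ i])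
    then show "x \<in> \<Union>F" using ws(2) by blast
  qed
  also have "?R \<in> sets M"
    by (rule sets.countable_UN'') (auto intro: measurable_sets[OF L meas])
  finally show ?thesis .
qed

lemma conn_sets_finite: "Y \<in> conn_sets M E k \<Longrightarrow> finite Y"
  by (auto simp: conn_sets_def intro: card_ge_0_finite)

text \<open>Two points of a connected set are joined by a path whose length is at most the number of
  edges inside it, hence at most \<open>k * k\<close>. The set thus lies in a ball of that radius
  around \<open>x\<close>, which is finite.\<close>

lemma finite_conn_sets_at: "finite {Y \<in> conn_sets M E k. x \<in> Y}"
proof -
  let ?R = "\<lambda>n. {y. (x, y) \<in> E ^^ n}"
  have "finite (?R n)" for n
  proof (induction n)
    case (Suc n)
    have "?R (Suc n) \<subseteq> (\<Union>y\<in>?R n. {z. (y, z) \<in> E})" by auto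
    then show ?case using Suc finite_out_edges by (meson finite_UN_I finite_subset)
  qed simp
  then have fin: "finite (\<Union>n\<le>k * k. ?R n)" by blast
  have "Y \<subseteq> (\<Union>n\<le>k * k. ?R n)" if Y: "Y \<in> conn_sets M E k" "x \<in> Y" for Y
  proof
    fix y assume y: "y \<in> Y"
    let ?E = "E \<inter> Y \<times> Y"
    have fY: "finite Y" using conn_sets_finite Y(1) .
    then have "finite ?E" by auto
    moreover have "(x, y) \<in> ?E\<^sup>*" using Y y by (auto simp: conn_sets_def induces_connected_def)
    ultimately obtain n where n: "n \<le> card ?E" "(x, y) \<in> ?E ^^ n"
      using rtrancl_finite_eq_relpow by blast
    have "card ?E \<le> card Y * card Y"
      using card_mono[of "Y \<times> Y" ?E] fY by (simp add: card_cartesian_product)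
    also have "\<dots> \<le> k * k" using Y(1) by (intro mult_le_mono) (auto simp: conn_sets_def)
    finally have "n \<le> k * k" using n(1) by simp
    moreover have "?E ^^ n \<subseteq> E ^^ n" by (induction n) auto
    then have "(x, y) \<in> E ^^ n" using n(2) by blast
    ultimately show "y \<in> (\<Union>n\<le>k * k. ?R n)" by blast
  qed
  then have "{Y \<in> conn_sets M E k. x \<in> Y} \<subseteq> Pow (\<Union>n\<le>k * k. ?R n)" by blast
  then show ?thesis using fin by (meson finite_Pow_iff finite_subset)
qed

text \<open>A path inside the listed set visits points with known indices, so for each length its
  existence is a finite combination of edge conditions, and the length ranges over a countable
  set.\<close>

lemma listings_conn_sets: "listings M m (conn_sets M E k) \<in> sets (\<Pi>\<^sub>M i\<in>{..<m}. M)" (is "_ \<in> sets ?P")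
proof -
  have coord: "(\<lambda>x. x i) \<in> ?P \<rightarrow>\<^sub>M M" if "i < m" for i
    using that by (intro measurable_component_singleton) simp
  have edge: "{x \<in> space ?P. (x i, x j) \<in> E} \<in> sets ?P" if "i < m" "j < m" for i j
    using measurable_sets[OF measurable_Pair[OF coord[OF that(1)] coord[OF that(2)]] edges_borel]
    by (simp add: vimage_def Int_def conj_commute)
  have path: "{x \<in> space ?P. (x i, x j) \<in> (E \<inter> x ` {..<m} \<times> x ` {..<m}) ^^ n} \<in> sets ?P"
    if "i < m" "j < m" for i j n
    using that
  proof (induction n arbitrary: j)
    case 0
    show ?case using measurable_equality[OF coord[OF 0(1)] coord[OF 0(2)]] by simp
  next
    case (Suc n)
    have "{x \<in> space ?P. (x i, x j) \<in> (E \<inter> x ` {..<m} \<times> x ` {..<m}) ^^ Suc n}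
        = (\<Union>l\<in>{..<m}. {x \<in> space ?P. (x i, x l) \<in> (E \<inter> x ` {..<m} \<times> x ` {..<m}) ^^ n}
            \<inter> {x \<in> space ?P. (x l, x j) \<in> E})"
      using Suc.prems by (auto simp: relcomp_unfold)
    also have "\<dots> \<in> sets ?P" using Suc.prems by (intro sets.finite_UN sets.Int Suc.IH edge) auto
    finally show ?case .
  qed
  have "listings M m (conn_sets M E k) =
      (if 1 \<le> m \<and> m \<le> k then
        {x \<in> space ?P. inj_on x {..<m}} \<inter>
        {x \<in> space ?P. \<forall>i\<in>{..<m}. \<forall>j\<in>{..<m}. \<exists>n. (x i, x j) \<in> (E \<inter> x ` {..<m} \<times> x ` {..<m}) ^^ n}
       else {})"
    by (auto simp: listings_def conn_sets_def induces_connected_def card_image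
        rtrancl_power space_PiM PiE_iff)
  moreover have "{x \<in> space ?P. inj_on x {..<m}} \<in> sets ?P"
    unfolding inj_on_def
    by (intro sets.sets_Collect_finite_All sets.sets_Collect_imp sets.sets_Collect_const
        measurable_equality coord finite_lessThan) (simp_all only: lessThan_iff)
  moreover have "{x \<in> space ?P. \<forall>i\<in>{..<m}. \<forall>j\<in>{..<m}.
      \<exists>n. (x i, x j) \<in> (E \<inter> x ` {..<m} \<times> x ` {..<m}) ^^ n} \<in> sets ?P"
    by (intro sets.sets_Collect_finite_All sets.sets_Collect_countable_Ex path finite_lessThan)
      (simp_all only: lessThan_iff)
  ultimately show ?thesis by simp
qed

section \<open>The Borel structure on connected sets and its measurable functions\<close>

lemma sets_conn_space:
  "sets (conn_space M E k) =
     {F. F \<subseteq> conn_sets M E k \<and> (\<forall>m. listings M m F \<in> sets (\<Pi>\<^sub>M i\<in>{..<m}. M))}" (is "_ = ?F")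
proof -
  have "sigma_algebra (conn_sets M E k) ?F"
    unfolding sigma_algebra_iff2
  proof (intro conjI ballI allI impI)
    show "?F \<subseteq> Pow (conn_sets M E k)" by auto
    show "{} \<in> ?F" by (simp add: listings_def)
    fix F assume F: "F \<in> ?F"
    have "listings M m (conn_sets M E k - F) = listings M m (conn_sets M E k) - listings M m F" for m
      by (auto simp: listings_def)
    then show "conn_sets M E k - F \<in> ?F" using F listings_conn_sets by auto
  next
    fix A :: "nat \<Rightarrow> 'a set set" assume A: "range A \<subseteq> ?F"
    have "listings M m (\<Union>i. A i) = (\<Union>i. listings M m (A i))" for m
      by (auto simp: listings_def)
    moreover have "(\<Union>i. listings M m (A i)) \<in> sets (\<Pi>\<^sub>M i\<in>{..<m}. M)" for m
      using A by (intro sets.countable_UN) auto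
    ultimately show "(\<Union>i. A i) \<in> ?F" using A by auto
  qed
  then show ?thesis
    unfolding conn_space_def by (rule sigma_algebra.sets_measure_of_eq)
qed

lemma space_conn_space: "space (conn_space M E k) = conn_sets M E k"
  by (simp add: conn_space_def space_measure_of_conv)

lemma Union_conn_space_measurable: "F \<in> sets (conn_space M E k) \<Longrightarrow> \<Union>F \<in> sets M"
  by (rule Union_listings_measurable[of F k]) (auto simp: sets_conn_space)

text \<open>Reduces a function of sets to a formula in the coordinates. Agreement on injective
  listings suffices, since these alone determine which families are measurable.\<close>

lemma measurable_conn_spaceI:
  fixes f :: "'a set \<Rightarrow> real"
  assumes f': "\<And>m. f' m \<in> borel_measurable (\<Pi>\<^sub>M i\<in>{..<m}. M)"
    and eq: "\<And>m x. x \<in> listings M m (conn_sets M E k) \<Longrightarrow> f (x ` {..<m}) = f' m x"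
  shows "f \<in> borel_measurable (conn_space M E k)"
proof (rule measurableI)
  fix B :: "real set" assume B: "B \<in> sets borel"
  have "listings M m (f -` B \<inter> conn_sets M E k) =
      listings M m (conn_sets M E k) \<inter> (f' m -` B \<inter> space (\<Pi>\<^sub>M i\<in>{..<m}. M))" for m
    using eq[of _ m] by (auto simp: listings_def)
  then show "f -` B \<inter> space (conn_space M E k) \<in> sets (conn_space M E k)"
    using measurable_sets[OF f' B] listings_conn_sets by (auto simp: space_conn_space sets_conn_space)
qed simp

lemma measurable_fraction:
  assumes X: "X \<in> sets M"
  shows "(\<lambda>Y. real (card (X \<inter> Y)) / real (card Y)) \<in> borel_measurable (conn_space M E k)"
proof (rule measurable_conn_spaceI)
  fix m
  show "(\<lambda>x. (\<Sum>i<m. indicator X (x i)) / real m) \<in> borel_measurable (\<Pi>\<^sub>M i\<in>{..<m}. M)"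
    using X by measurable
  fix x assume "x \<in> listings M m (conn_sets M E k)"
  then have inj: "inj_on x {..<m}" by (simp add: listings_def)
  have "real (card (X \<inter> x ` {..<m})) = (\<Sum>y\<in>x ` {..<m}. indicator X y)"
    by (simp add: indicator_def sum.If_cases Int_commute)
  also have "\<dots> = (\<Sum>i<m. indicator X (x i))" by (simp add: sum.reindex[OF inj])
  finally show "real (card (X \<inter> x ` {..<m})) / real (card (x ` {..<m})) = (\<Sum>i<m. indicator X (x i)) / real m"
    using inj by (simp add: card_image)
qed

text \<open>Edges out of points of \<open>Y\<close> minus those that stay inside: loops cancel, and
  both sums are built from functions that are measurable in the coordinates of a listing.\<close>

lemma card_edge_boundary:
  assumes "finite Y"
  shows "real (card (edge_boundary E Y)) =
    (\<Sum>y\<in>Y. real (card {z. (y, z) \<in> E})) - (\<Sum>y\<in>Y. \<Sum>z\<in>Y. indicator E (y, z))"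
proof -
  have "edge_boundary E Y = Sigma Y (\<lambda>y. {z. (y, z) \<in> E} - Y)" by (auto simp: edge_boundary_def)
  then have "real (card (edge_boundary E Y)) = (\<Sum>y\<in>Y. real (card ({z. (y, z) \<in> E} - Y)))"
    using assms finite_out_edges by (simp add: card_SigmaI)
  also have "\<dots> = (\<Sum>y\<in>Y. real (card {z. (y, z) \<in> E}) - (\<Sum>z\<in>Y. indicator E (y, z)))"
  proof (rule sum.cong)
    fix y
    have "card ({z. (y, z) \<in> E} - Y) = card {z. (y, z) \<in> E} - card ({z. (y, z) \<in> E} \<inter> Y)"
      using assms by (simp add: card_Diff_subset_Int)
    moreover have "card ({z. (y, z) \<in> E} \<inter> Y) \<le> card {z. (y, z) \<in> E}"
      by (intro card_mono finite_out_edges) auto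
    moreover have "(\<Sum>z\<in>Y. indicator E (y, z)) = real (card ({z. (y, z) \<in> E} \<inter> Y))"
      using assms by (simp add: indicator_def sum.If_cases Int_commute)
    ultimately show "real (card ({z. (y, z) \<in> E} - Y)) = real (card {z. (y, z) \<in> E}) - (\<Sum>z\<in>Y. indicator E (y, z))"
      by simp
  qed simp
  finally show ?thesis by (simp add: sum_subtractf)
qed

lemma card_edge_boundary_le:
  assumes "finite Y"
  shows "card (edge_boundary E Y) \<le> D * card Y"
proof -
  have "real (card (edge_boundary E Y)) \<le> (\<Sum>y\<in>Y. real (card {z. (y, z) \<in> E}))"
    unfolding card_edge_boundary[OF assms] by (simp add: sum_nonneg)
  also have "\<dots> \<le> (\<Sum>y\<in>Y. real D)" using card_out_edges by (intro sum_mono) simp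
  finally have "real (card (edge_boundary E Y)) \<le> real (D * card Y)" by (simp add: mult.commute)
  then show ?thesis by (simp only: of_nat_le_iff)
qed

lemma measurable_expansion: "expansion E \<in> borel_measurable (conn_space M E k)"
proof (rule measurable_conn_spaceI)
  fix m :: nat
  let ?P = "\<Pi>\<^sub>M i\<in>{..<m}. M"
  let ?f = "\<lambda>x. ((\<Sum>i<m. real (card {z. (x i, z) \<in> E})) - (\<Sum>i<m. \<Sum>j<m. indicator E (x i, x j))) / real m"
  have deg: "(\<lambda>x. real (card {z. (x, z) \<in> E})) \<in> borel_measurable M"
    by (rule measurable_compose[OF measurable_degree]) simp
  have coord: "(\<lambda>x. x i) \<in> ?P \<rightarrow>\<^sub>M M" if "i \<in> {..<m}" for i
    using that by (intro measurable_component_singleton) simp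
  show "?f \<in> borel_measurable ?P"
    by (intro borel_measurable_divide borel_measurable_diff borel_measurable_sum borel_measurable_const
        measurable_compose[OF coord deg] measurable_compose[OF _ borel_measurable_indicator[OF edges_borel]]
        measurable_Pair coord)
  fix x assume "x \<in> listings M m (conn_sets M E k)"
  then have inj: "inj_on x {..<m}" by (simp add: listings_def)
  then show "expansion E (x ` {..<m}) = ?f x"
    by (simp add: expansion_def card_edge_boundary sum.reindex card_image)
qed

end

subsection \<open>Sublinear functionals\<close>

locale function_subspace =
  fixes V :: "('b \<Rightarrow> real) set"
  assumes add: "f \<in> V \<Longrightarrow> g \<in> V \<Longrightarrow> (\<lambda>x. f x + g x) \<in> V"
    and scale: "f \<in> V \<Longrightarrow> (\<lambda>x. c * f x) \<in> V"
    and zero: "(\<lambda>x. 0) \<in> V"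
begin

text \<open>Homogeneity is required as an inequality only, the form that infima yield directly;
  applying it to the inverse factor gives equality.\<close>

definition sublinear :: "(('b \<Rightarrow> real) \<Rightarrow> real) \<Rightarrow> bool" where
  "sublinear q \<longleftrightarrow> (\<forall>f\<in>V. \<forall>g\<in>V. q (\<lambda>x. f x + g x) \<le> q f + q g) \<and>
     (\<forall>f\<in>V. \<forall>c>0. q (\<lambda>x. c * f x) \<le> c * q f)"

lemma sublinear_add: "sublinear q \<Longrightarrow> f \<in> V \<Longrightarrow> g \<in> V \<Longrightarrow> q (\<lambda>x. f x + g x) \<le> q f + q g"
  by (auto simp: sublinear_def)

lemma sublinear_scale:
  assumes q: "sublinear q" and f: "f \<in> V" and c: "c > 0"
  shows "q (\<lambda>x. c * f x) = c * q f"
proof (rule antisym)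
  show "q (\<lambda>x. c * f x) \<le> c * q f" using assms by (auto simp: sublinear_def)
  have "q (\<lambda>x. (1/c) * (c * f x)) \<le> (1/c) * q (\<lambda>x. c * f x)"
    using q scale[OF f, of c] c unfolding sublinear_def by (metis divide_pos_pos zero_less_one)
  then show "c * q f \<le> q (\<lambda>x. c * f x)" using c by (simp add: field_simps)
qed

lemma uminus: "f \<in> V \<Longrightarrow> (\<lambda>x. - f x) \<in> V"
  using scale[of f "-1"] by simp

lemma sublinear_zero: "sublinear q \<Longrightarrow> q (\<lambda>x. 0) = 0"
  using sublinear_scale[of q "\<lambda>x. 0" 2] zero by simp

lemma sublinear_uminus: "sublinear q \<Longrightarrow> f \<in> V \<Longrightarrow> - q (\<lambda>x. - f x) \<le> q f"
  using sublinear_add[of q f "\<lambda>x. - f x"] uminus sublinear_zero[of q] by simp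

text \<open>A linear \<open>L\<close> below \<open>q\<close> with \<open>L f = q f\<close> satisfies
  \<open>L g = L (g + t f) - t q f\<close>, which is at most every term of this infimum. The tilt is
  the bound that such functionals obey automatically.\<close>

definition tilt :: "(('b \<Rightarrow> real) \<Rightarrow> real) \<Rightarrow> ('b \<Rightarrow> real) \<Rightarrow> ('b \<Rightarrow> real) \<Rightarrow> real" where
  "tilt q f g = (INF t\<in>{0..}. q (\<lambda>x. g x + t * f x) - t * q f)"

text \<open>The lower bound does not depend on \<open>t\<close>, so the infimum defining
  \<open>tilt\<close> is over a set bounded below.\<close>

lemma tilt_bound:
  assumes q: "sublinear q" and f: "f \<in> V" and g: "g \<in> V" and t: "t \<ge> 0"
  shows "- q (\<lambda>x. - g x) \<le> q (\<lambda>x. g x + t * f x) - t * q f"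
proof (cases "t = 0")
  case True
  then show ?thesis using sublinear_uminus[OF q g] by simp
next
  case False
  then have "t * q f = q (\<lambda>x. (g x + t * f x) + - g x)"
    using sublinear_scale[OF q f, of t] t by simp
  also have "\<dots> \<le> q (\<lambda>x. g x + t * f x) + q (\<lambda>x. - g x)"
    by (intro sublinear_add q add scale uminus f g)
  finally show ?thesis by simp
qed

lemma tilt_le:
  assumes "sublinear q" "f \<in> V" "g \<in> V" "t \<ge> 0"
  shows "tilt q f g \<le> q (\<lambda>x. g x + t * f x) - t * q f"
  unfolding tilt_def
proof (rule cINF_lower)
  show "bdd_below ((\<lambda>t. q (\<lambda>x. g x + t * f x) - t * q f) ` {0..})"
    using tilt_bound[OF assms(1-3)] by (intro bdd_belowI2) auto
qed (use assms in simp)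

lemma tilt_greatest:
  assumes "\<And>t. t \<ge> 0 \<Longrightarrow> a \<le> q (\<lambda>x. g x + t * f x) - t * q f"
  shows "a \<le> tilt q f g"
  unfolding tilt_def using assms by (intro cINF_greatest) auto

lemma sublinear_tilt:
  assumes q: "sublinear q" and f: "f \<in> V"
  shows "sublinear (tilt q f)"
  unfolding sublinear_def
proof (intro conjI ballI allI impI)
  fix g h assume g: "g \<in> V" and h: "h \<in> V"
  \<comment> \<open>Parameters add: the terms at \<open>s\<close> for \<open>g\<close> and at
    \<open>t\<close> for \<open>h\<close> together bound the term at \<open>s + t\<close> for the
    sum, and the two infima can then be taken separately.\<close>
  have *: "tilt q f (\<lambda>x. g x + h x)
      \<le> (q (\<lambda>x. g x + s * f x) - s * q f) + (q (\<lambda>x. h x + t * f x) - t * q f)"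
    if "s \<ge> 0" "t \<ge> 0" for s t
  proof -
    have "tilt q f (\<lambda>x. g x + h x) \<le> q (\<lambda>x. (g x + h x) + (s + t) * f x) - (s + t) * q f"
      using that by (intro tilt_le q f add g h) auto
    also have "(\<lambda>x. (g x + h x) + (s + t) * f x) = (\<lambda>x. (g x + s * f x) + (h x + t * f x))"
      by (simp add: algebra_simps)
    also have "q \<dots> \<le> q (\<lambda>x. g x + s * f x) + q (\<lambda>x. h x + t * f x)"
      by (intro sublinear_add q add scale f g h)
    finally show ?thesis by (simp add: algebra_simps)
  qed
  have "tilt q f (\<lambda>x. g x + h x) - (q (\<lambda>x. g x + s * f x) - s * q f) \<le> tilt q f h" if "s \<ge> 0" for s
    using *[OF that] by (intro tilt_greatest) (simp add: algebra_simps)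
  then have "tilt q f (\<lambda>x. g x + h x) - tilt q f h \<le> tilt q f g"
    by (intro tilt_greatest) (simp add: algebra_simps)
  then show "tilt q f (\<lambda>x. g x + h x) \<le> tilt q f g + tilt q f h" by simp
next
  fix g c assume g: "g \<in> V" and c: "(0 :: real) < c"
  have "tilt q f (\<lambda>x. c * g x) / c \<le> tilt q f g"
  proof (rule tilt_greatest)
    fix t :: real assume t: "t \<ge> 0"
    have "tilt q f (\<lambda>x. c * g x) \<le> q (\<lambda>x. c * g x + (c * t) * f x) - (c * t) * q f"
      using c t by (intro tilt_le q f scale g) auto
    also have "(\<lambda>x. c * g x + (c * t) * f x) = (\<lambda>x. c * (g x + t * f x))"
      by (simp add: algebra_simps)
    also have "q \<dots> = c * q (\<lambda>x. g x + t * f x)"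
      by (intro sublinear_scale q c add scale g f)
    finally show "tilt q f (\<lambda>x. c * g x) / c \<le> q (\<lambda>x. g x + t * f x) - t * q f"
      using c by (simp add: field_simps)
  qed
  then show "tilt q f (\<lambda>x. c * g x) \<le> c * tilt q f g" using c by (simp add: field_simps)
qed

text \<open>
  A minimal sublinear functional is fixed by every tilt, and this forces it to be additive.
\<close>

lemma linear_minorant:
  assumes p: "sublinear p"
  obtains L where "\<And>f g. f \<in> V \<Longrightarrow> g \<in> V \<Longrightarrow> L (\<lambda>x. f x + g x) = L f + L g"
    "\<And>f c. f \<in> V \<Longrightarrow> L (\<lambda>x. c * f x) = c * L f" "\<And>f. f \<in> V \<Longrightarrow> L f \<le> p f"
proof -
  \<comment> \<open>Fixing the value \<open>0\<close> outside \<open>V\<close> makes two members of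
    \<open>Q\<close> equal as soon as they agree on \<open>V\<close>, so the pointwise order
    compares only their restrictions.\<close>
  define Q where "Q = {q. sublinear q \<and> (\<forall>f\<in>V. q f \<le> p f) \<and> (\<forall>f. f \<notin> V \<longrightarrow> q f = 0)}"
  have restrict: "(\<lambda>f. if f \<in> V then q f else 0) \<in> Q" if "sublinear q" "\<forall>f\<in>V. q f \<le> p f" for q
    using that by (auto simp: Q_def sublinear_def add scale)
  have Q_bound: "- p (\<lambda>x. - f x) \<le> q f" if "q \<in> Q" "f \<in> V" for q f
    using that sublinear_uminus[of q f] uminus by (force simp: Q_def)
  \<comment> \<open>Zorn's lemma is applied to the reversed order, in which the pointwise infimum of
    a chain is an upper bound.\<close>
  have "\<exists>L\<in>Q. \<forall>q\<in>Q. q \<le> L \<longrightarrow> q = L"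
  proof (rule predicate_Zorn)
    show "partial_order_on Q (relation_of (\<lambda>q r. r \<le> q) Q)"
      by (auto simp: partial_order_on_def preorder_on_def refl_on_def trans_def antisym_def relation_of_def)
    fix C assume C: "C \<in> Chains (relation_of (\<lambda>q r. r \<le> q) Q)"
    then have CQ: "C \<subseteq> Q" and chain: "\<And>q r. q \<in> C \<Longrightarrow> r \<in> C \<Longrightarrow> q \<le> r \<or> r \<le> q"
      by (auto simp: Chains_def relation_of_def)
    show "\<exists>u\<in>Q. \<forall>q\<in>C. u \<le> q"
    proof (cases "C = {}")
      case True
      then show ?thesis using restrict[OF p] by auto
    next
      case False
      define u where "u f = (INF q\<in>C. q f)" for f
      have u_le: "u f \<le> q f" if "q \<in> C" "f \<in> V" for q f
        unfolding u_def
      proof (rule cINF_lower)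
        show "bdd_below ((\<lambda>q. q f) ` C)" using Q_bound CQ \<open>f \<in> V\<close> by (intro bdd_belowI2) auto
      qed fact
      have u_greatest: "a \<le> u f" if "\<And>q. q \<in> C \<Longrightarrow> a \<le> q f" for a f
        unfolding u_def using False that by (intro cINF_greatest) auto
      have "sublinear u"
        unfolding sublinear_def
      proof (intro conjI ballI allI impI)
        fix f g assume fg: "f \<in> V" "g \<in> V"
        have *: "u (\<lambda>x. f x + g x) \<le> q f + r g" if qr: "q \<in> C" "r \<in> C" for q r
        proof -
          \<comment> \<open>The infimum of sublinear functionals need not be subadditive in general;
            along a chain, the smaller of two members bounds both summands at once.\<close>
          obtain m where m: "m \<in> C" "m \<le> q" "m \<le> r" using chain[OF qr] qr by blast
          have "u (\<lambda>x. f x + g x) \<le> m (\<lambda>x. f x + g x)" using m(1) fg by (intro u_le add)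
          also have "\<dots> \<le> m f + m g" using m(1) CQ fg by (intro sublinear_add) (auto simp: Q_def)
          also have "\<dots> \<le> q f + r g" using m by (intro add_mono) (auto simp: le_fun_def)
          finally show ?thesis .
        qed
        have "u (\<lambda>x. f x + g x) - q f \<le> u g" if "q \<in> C" for q
          using *[OF that] by (intro u_greatest) (simp add: algebra_simps)
        then have "u (\<lambda>x. f x + g x) - u g \<le> u f"
          by (intro u_greatest) (simp add: algebra_simps)
        then show "u (\<lambda>x. f x + g x) \<le> u f + u g" by simp
      next
        fix f c assume f: "f \<in> V" and c: "(0::real) < c"
        have "u (\<lambda>x. c * f x) / c \<le> u f"
        proof (rule u_greatest)
          fix q assume q: "q \<in> C"
          have "u (\<lambda>x. c * f x) \<le> q (\<lambda>x. c * f x)" using q f by (intro u_le scale)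
          also have "\<dots> = c * q f" using q CQ f c by (intro sublinear_scale) (auto simp: Q_def)
          finally show "u (\<lambda>x. c * f x) / c \<le> q f" using c by (simp add: field_simps)
        qed
        then show "u (\<lambda>x. c * f x) \<le> c * u f" using c by (simp add: field_simps)
      qed
      moreover have "u f \<le> p f" if f: "f \<in> V" for f
      proof -
        obtain q where "q \<in> C" using False by blast
        then show ?thesis using u_le[of q f] f CQ by (force simp: Q_def)
      qed
      ultimately have "(\<lambda>f. if f \<in> V then u f else 0) \<in> Q" by (intro restrict) auto
      moreover have "(\<lambda>f. if f \<in> V then u f else 0) \<le> q" if "q \<in> C" for q
        using u_le[OF that] CQ that by (auto simp: le_fun_def Q_def)
      ultimately show ?thesis by blast
    qed
  qed
  then obtain L where L: "L \<in> Q" "\<And>q. q \<in> Q \<Longrightarrow> q \<le> L \<Longrightarrow> q = L" by blast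
  then have sub: "sublinear L" and Lp: "\<And>f. f \<in> V \<Longrightarrow> L f \<le> p f" by (auto simp: Q_def)
  have L_add: "L (\<lambda>x. f x + g x) = L f + L g" if f: "f \<in> V" and g: "g \<in> V" for f g
  proof (rule antisym)
    show "L (\<lambda>x. f x + g x) \<le> L f + L g" by (intro sublinear_add sub f g)
    \<comment> \<open>The tilt lies in \<open>Q\<close> below the minimal \<open>L\<close>, so the
      two agree on \<open>V\<close>; its term with \<open>t = 1\<close> gives the missing
      superadditivity.\<close>
    let ?T = "\<lambda>g. if g \<in> V then tilt L f g else 0"
    have le: "tilt L f g \<le> L g" if "g \<in> V" for g
      using tilt_le[OF sub f that, of 0] by simp
    have "?T \<in> Q"
      using le Lp by (intro restrict sublinear_tilt sub f) (auto intro: order_trans)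
    moreover have "?T \<le> L" using le L(1) by (auto simp: le_fun_def Q_def)
    ultimately have T: "?T = L" by (rule L(2))
    have "L g = tilt L f g" using fun_cong[OF T, of g] g by simp
    also have "\<dots> \<le> L (\<lambda>x. g x + 1 * f x) - 1 * L f" by (intro tilt_le sub f g) simp
    finally show "L f + L g \<le> L (\<lambda>x. f x + g x)" by (simp add: add.commute)
  qed
  have L_uminus: "L (\<lambda>x. - f x) = - L f" if "f \<in> V" for f
    using L_add[OF that uminus[OF that]] sublinear_zero[OF sub] by simp
  have L_scale: "L (\<lambda>x. c * f x) = c * L f" if f: "f \<in> V" for f c
  proof -
    consider "c > 0" | "c = 0" | "c < 0" by linarith
    then show ?thesis
    proof cases
      case 1
      then show ?thesis using sublinear_scale[OF sub f] by simp
    next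
      case 2
      then show ?thesis using sublinear_zero[OF sub] by simp
    next
      case 3
      then have "L (\<lambda>x. (- c) * - f x) = (- c) * L (\<lambda>x. - f x)"
        by (intro sublinear_scale sub uminus f) simp
      then show ?thesis using L_uminus[OF f] by simp
    qed
  qed
  show thesis using that[of L] L_add L_scale Lp by blast
qed

text \<open>A linear functional below \<open>tilt p f0\<close> lies below \<open>p\<close> by the
  term \<open>t = 0\<close>, and the term \<open>t = 1\<close> at \<open>- f0\<close> forces it to
  reach \<open>p f0\<close>.\<close>

lemma hahn_banach:
  assumes p: "sublinear p" and f0: "f0 \<in> V"
  obtains L where "\<And>f g. f \<in> V \<Longrightarrow> g \<in> V \<Longrightarrow> L (\<lambda>x. f x + g x) = L f + L g"
    "\<And>f c. f \<in> V \<Longrightarrow> L (\<lambda>x. c * f x) = c * L f" "\<And>f. f \<in> V \<Longrightarrow> L f \<le> p f" "L f0 = p f0"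
proof -
  obtain L where L: "\<And>f g. f \<in> V \<Longrightarrow> g \<in> V \<Longrightarrow> L (\<lambda>x. f x + g x) = L f + L g"
    "\<And>f c. f \<in> V \<Longrightarrow> L (\<lambda>x. c * f x) = c * L f" "\<And>f. f \<in> V \<Longrightarrow> L f \<le> tilt p f0 f"
    using linear_minorant[OF sublinear_tilt[OF p f0]] by blast
  have Lp: "L f \<le> p f" if "f \<in> V" for f
    using L(3)[OF that] tilt_le[OF p f0 that, of 0] by simp
  have "- L f0 = L (\<lambda>x. - f0 x)" using L(2)[OF f0, of "-1"] by simp
  also have "\<dots> \<le> p (\<lambda>x. - f0 x + 1 * f0 x) - 1 * p f0"
    using L(3)[OF uminus[OF f0]] tilt_le[OF p f0 uminus[OF f0], of 1] by simp
  also have "\<dots> = - p f0" using sublinear_zero[OF p] by simp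
  finally have "L f0 = p f0" using Lp[OF f0] by simp
  then show thesis using that[of L] L(1,2) Lp by blast
qed

end

subsection \<open>Duality\<close>

context graphing
begin

lemma conn_setsD:
  assumes "Y \<in> conn_sets M E k"
  shows "finite Y" "Y \<noteq> {}" "Y \<subseteq> space M" "card Y > 0" "card Y \<le> k"
  using assms conn_sets_finite[OF assms] by (auto simp: conn_sets_def)

lemma singleton_conn_sets: "x \<in> space M \<Longrightarrow> k \<ge> 1 \<Longrightarrow> {x} \<in> conn_sets M E k"
  by (auto simp: conn_sets_def induces_connected_def)

lemma measurable_average:
  assumes g: "g \<in> borel_measurable M"
  shows "average g \<in> borel_measurable (conn_space M E k)"
proof (rule measurable_conn_spaceI)
  fix m :: nat
  have coord: "(\<lambda>x. x i) \<in> (\<Pi>\<^sub>M i\<in>{..<m}. M) \<rightarrow>\<^sub>M M" if "i \<in> {..<m}" for i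
    using that by (intro measurable_component_singleton) simp
  show "(\<lambda>x. 1 / real m * (\<Sum>i<m. g (x i))) \<in> borel_measurable (\<Pi>\<^sub>M i\<in>{..<m}. M)"
    by (intro borel_measurable_times borel_measurable_sum borel_measurable_const measurable_compose[OF coord g])
  fix x assume "x \<in> listings M m (conn_sets M E k)"
  then have inj: "inj_on x {..<m}" by (simp add: listings_def)
  then show "average g (x ` {..<m}) = 1 / real m * (\<Sum>i<m. g (x i))"
    by (simp add: average_def sum.reindex card_image)
qed

lemma average_bound:
  assumes "Y \<in> conn_sets M E k" "\<And>x. x \<in> space M \<Longrightarrow> \<bar>g x\<bar> \<le> B"
  shows "\<bar>average g Y\<bar> \<le> B"
proof -
  have "\<bar>\<Sum>y\<in>Y. g y\<bar> \<le> (\<Sum>y\<in>Y. B)"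
    using conn_setsD(3)[OF assms(1)] assms(2) by (intro order_trans[OF sum_abs] sum_mono) auto
  then show ?thesis
    using conn_setsD(4)[OF assms(1)] by (simp add: average_def abs_mult field_simps)
qed

lemma average_indicator: "finite Y \<Longrightarrow> average (indicator X) Y = real (card (X \<inter> Y)) / real (card Y)"
  by (simp add: average_def indicator_def sum.If_cases Int_commute)

lemma expansion_bound:
  assumes "Y \<in> conn_sets M E k"
  shows "0 \<le> expansion E Y" "expansion E Y \<le> D"
  using card_edge_boundary_le[OF conn_setsD(1)[OF assms]] conn_setsD(4)[OF assms]
  by (simp_all add: expansion_def field_simps flip: of_nat_mult)

lemma integrable_bounded:
  fixes g :: "'a \<Rightarrow> real"
  assumes "g \<in> borel_measurable M" "bounded (g ` space M)"
  shows "integrable M g"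
proof -
  obtain B where "\<And>x. x \<in> space M \<Longrightarrow> norm (g x) \<le> B"
    using assms(2) by (auto simp: bounded_iff)
  then show ?thesis using assms(1) by (intro integrable_const_bound[of _ B]) auto
qed

lemma integral_average:
  assumes \<tau>: "\<tau> \<in> fractional_partitions M E k" and g: "g \<in> borel_measurable M"
    and b: "\<And>x. x \<in> space M \<Longrightarrow> \<bar>g x\<bar> \<le> B"
  shows "(\<integral>Y. average g Y \<partial>\<tau>) = (\<integral>x. g x \<partial>M)"
proof -
  interpret \<tau>: prob_space \<tau> using \<tau> by (simp add: fractional_partitions_def)
  have sets: "sets \<tau> = sets (conn_space M E k)" and marg: "\<And>X. X \<in> sets M \<Longrightarrow> marginal \<tau> X = emeasure M X"
    using \<tau> by (auto simp: fractional_partitions_def)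
  have space: "space \<tau> = conn_sets M E k"
    using sets_eq_imp_space_eq[OF sets] by (simp add: space_conn_space)
  \<comment> \<open>The uniform measure on \<open>Y\<close> lives on all subsets of
    \<open>Y\<close>; pushing it forward along the identity puts it on the sigma-algebra of
    \<open>M\<close>, as a kernel requires.\<close>
  define K where "K Y = distr (uniform_count_measure Y) M (\<lambda>x. x)" for Y :: "'a set"
  have id: "(\<lambda>x. x) \<in> uniform_count_measure Y \<rightarrow>\<^sub>M M" if "Y \<in> space \<tau>" for Y
    using conn_setsD(3)[of Y k] that
    by (auto simp: space measurable_def space_uniform_count_measure sets_uniform_count_measure)
  have K_prob: "prob_space (K Y)" if "Y \<in> space \<tau>" for Y
    unfolding K_def using conn_setsD(1,2)[of Y k] that
    by (intro prob_space.prob_space_distr id prob_space_uniform_count_measure) (auto simp: space)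
  have K_emeasure: "emeasure (K Y) X = ennreal (real (card (X \<inter> Y)) / real (card Y))"
    if "Y \<in> space \<tau>" "X \<in> sets M" for X Y
    using that conn_setsD(1)[of Y k]
    by (simp add: K_def emeasure_distr[OF id] space space_uniform_count_measure
        emeasure_uniform_count_measure)
  have K: "K \<in> \<tau> \<rightarrow>\<^sub>M subprob_algebra M"
  proof (rule measurable_subprob_algebra)
    fix X assume X: "X \<in> sets M"
    have "(\<lambda>Y. ennreal (real (card (X \<inter> Y)) / real (card Y))) \<in> borel_measurable \<tau>"
      using measurable_fraction[OF X, of k] by (simp cong: measurable_cong_sets add: sets)
    then show "(\<lambda>Y. emeasure (K Y) X) \<in> borel_measurable \<tau>"
      using K_emeasure[OF _ X] by (subst measurable_cong) auto
  qed (auto simp: K_def intro: K_prob[unfolded K_def] prob_space_imp_subprob_space)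
  \<comment> \<open>The marginal condition says exactly that mixing the kernel by
    \<open>\<tau>\<close> returns \<open>M\<close>.\<close>
  have "emeasure (\<tau> \<bind> K) X = emeasure M X" if X: "X \<in> sets M" for X
  proof -
    have "emeasure (\<tau> \<bind> K) X = (\<integral>\<^sup>+Y. emeasure (K Y) X \<partial>\<tau>)"
      by (rule emeasure_bind[OF \<tau>.not_empty K X])
    also have "\<dots> = marginal \<tau> X"
      unfolding marginal_def by (intro nn_integral_cong K_emeasure X)
    finally show ?thesis using marg[OF X] by simp
  qed
  then have "\<tau> \<bind> K = M"
    by (intro measure_eqI) (simp_all add: sets_bind_measurable[OF K \<tau>.not_empty])
  moreover have "integral\<^sup>L (\<tau> \<bind> K) g = (\<integral>Y. integral\<^sup>L (K Y) g \<partial>\<tau>)"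
  proof (rule integral_bind[OF g])
    show "\<And>x. x \<in> space M \<Longrightarrow> \<bar>g x\<bar> \<le> B" by (rule b)
    show "K \<in> \<tau> \<rightarrow>\<^sub>M subprob_algebra M" by (rule K)
    show "finite_measure \<tau>" by unfold_locales
    show "AE Y in \<tau>. emeasure (K Y) (space (K Y)) \<le> ennreal 1"
      using K_prob by (auto simp: prob_space.emeasure_space_1)
  qed
  moreover have "(\<integral>Y. integral\<^sup>L (K Y) g \<partial>\<tau>) = (\<integral>Y. average g Y \<partial>\<tau>)"
  proof (rule Bochner_Integration.integral_cong[OF refl])
    fix Y assume Y: "Y \<in> space \<tau>"
    have "integral\<^sup>L (K Y) g = integral\<^sup>L (uniform_count_measure Y) g"
      unfolding K_def by (rule integral_distr[OF id[OF Y] g])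
    then show "integral\<^sup>L (K Y) g = average g Y"
      using Y conn_setsD(1)[of Y k] by (simp add: space integral_uniform_count_measure average_def)
  qed
  ultimately show ?thesis by simp
qed

lemma weak_duality:
  assumes \<tau>: "\<tau> \<in> fractional_partitions M E k" and g: "g \<in> borel_measurable M" "bounded (g ` space M)"
    and le: "\<And>Y. Y \<in> conn_sets M E k \<Longrightarrow> average g Y \<le> expansion E Y"
  shows "(\<integral>x. g x \<partial>M) \<le> (\<integral>Y. expansion E Y \<partial>\<tau>)"
proof -
  interpret \<tau>: prob_space \<tau> using \<tau> by (simp add: fractional_partitions_def)
  have sets: "sets \<tau> = sets (conn_space M E k)" using \<tau> by (auto simp: fractional_partitions_def)
  have space: "space \<tau> = conn_sets M E k"
    using sets_eq_imp_space_eq[OF sets] by (simp add: space_conn_space)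
  obtain B where B: "\<And>x. x \<in> space M \<Longrightarrow> \<bar>g x\<bar> \<le> B" using g(2) by (auto simp: bounded_iff)
  have "(\<integral>x. g x \<partial>M) = (\<integral>Y. average g Y \<partial>\<tau>)"
    using integral_average[OF \<tau> g(1) B] by simp
  also have "\<dots> \<le> (\<integral>Y. expansion E Y \<partial>\<tau>)"
  proof (rule integral_mono)
    show "integrable \<tau> (average g)"
      using average_bound[OF _ B] measurable_average[OF g(1), of k]
      by (intro \<tau>.integrable_const_bound[of _ B]) (auto simp: space sets cong: measurable_cong_sets)
    show "integrable \<tau> (expansion E)"
      using expansion_bound measurable_expansion[of k]
      by (intro \<tau>.integrable_const_bound[of _ D]) (auto simp: space sets cong: measurable_cong_sets)
  qed (use le space in auto)
  finally show ?thesis .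
qed

end

text \<open>No measurability is imposed, so the functional can be evaluated at every indicator;
  functions of interest are extended by \<open>0\<close> off the connected sets.\<close>

definition bounded_functions :: "('b \<Rightarrow> real) set" where
  "bounded_functions = {f. \<exists>B. \<forall>x. \<bar>f x\<bar> \<le> B}"

interpretation bounded_functions: function_subspace bounded_functions
proof
  fix f g :: "'b \<Rightarrow> real" assume "f \<in> bounded_functions" "g \<in> bounded_functions"
  then obtain A B where "\<And>x. \<bar>f x\<bar> \<le> A" "\<And>x. \<bar>g x\<bar> \<le> B" by (auto simp: bounded_functions_def)
  then have "\<bar>f x + g x\<bar> \<le> A + B" for x by (meson abs_triangle_ineq add_mono order_trans)
  then show "(\<lambda>x. f x + g x) \<in> bounded_functions" by (auto simp: bounded_functions_def)
next
  fix f :: "'b \<Rightarrow> real" and c assume "f \<in> bounded_functions"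
  then obtain B where "\<And>x. \<bar>f x\<bar> \<le> B" by (auto simp: bounded_functions_def)
  then have "\<bar>c * f x\<bar> \<le> \<bar>c\<bar> * B" for x by (simp add: abs_mult mult_left_mono)
  then show "(\<lambda>x. c * f x) \<in> bounded_functions" by (auto simp: bounded_functions_def)
qed (auto simp: bounded_functions_def)

lemma indicator_bounded: "indicator A \<in> bounded_functions"
  by (auto simp: bounded_functions_def indicator_def intro!: exI[of _ 1])

lemma bounded_indicator: "bounded ((indicator A :: 'b \<Rightarrow> real) ` S)"
  by (rule bounded_subset[of "{0, 1}"]) (auto simp: indicator_def)

section \<open>Fractional partitions from positive functionals\<close>

context graphing
begin

lemma average_indicator_Union:
  assumes "Y \<in> F" "finite Y" "Y \<noteq> {}"
  shows "average (indicator (\<Union>F)) Y = 1"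
proof -
  have "\<Union>F \<inter> Y = Y" using assms(1) by blast
  then show ?thesis using assms(2,3) by (simp add: average_indicator)
qed

lemma measure_Union_tendsto_0:
  assumes A: "range A \<subseteq> sets (conn_space M E k)" "decseq A" "(\<Inter>i. A i) = {}"
  shows "(\<lambda>i. measure M (\<Union>(A i))) \<longlonglongrightarrow> 0"
proof -
  have "(\<lambda>i. measure M (\<Union>(A i))) \<longlonglongrightarrow> measure M (\<Inter>i. \<Union>(A i))"
  proof (rule finite_Lim_measure_decseq)
    show "range (\<lambda>i. \<Union>(A i)) \<subseteq> sets M"
    proof (rule image_subsetI)
      fix i
      have "A i \<in> sets (conn_space M E k)" using A(1) by auto
      then show "\<Union>(A i) \<in> sets M" by (rule Union_conn_space_measurable)
    qed
    show "decseq (\<lambda>i. \<Union>(A i))" using A(2) by (auto simp: decseq_def)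
  qed
  also have "(\<Inter>i. \<Union>(A i)) = {}"
  proof (rule ccontr)
    assume "(\<Inter>i. \<Union>(A i)) \<noteq> {}"
    then obtain x where "x \<in> (\<Inter>i. \<Union>(A i))" by blast
    then have x: "\<exists>Y\<in>A i. x \<in> Y" for i by auto
    have sub: "A i \<subseteq> conn_sets M E k" for i using A(1) by (auto simp: sets_conn_space)
    let ?S = "{Y \<in> conn_sets M E k. x \<in> Y}"
    have fin: "finite ?S" by (rule finite_conn_sets_at)
    have "\<forall>Y\<in>?S. \<exists>i. Y \<notin> A i" using A(3) by blast
    then obtain n where n: "\<And>Y. Y \<in> ?S \<Longrightarrow> Y \<notin> A (n Y)" by metis
    \<comment> \<open>\<open>n Y\<close> is a stage at which \<open>Y\<close> has left the
      decreasing families; at stage \<open>N\<close> none of the finitely many sets through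
      \<open>x\<close> remains.\<close>
    obtain N where N: "\<And>Y. Y \<in> ?S \<Longrightarrow> n Y < N"
      using finite_nat_bounded[of "n ` ?S"] fin by auto
    obtain Y where Y: "Y \<in> A N" "x \<in> Y" using x by blast
    then have YS: "Y \<in> ?S" using sub by blast
    have "A N \<subseteq> A (n Y)" using A(2) N[OF YS] by (simp add: decseq_def)
    then show False using Y(1) n[OF YS] by blast
  qed
  finally show ?thesis by simp
qed

text \<open>
  Countable additivity holds because a family has mass at most the measure of the set of vertices
  that it covers.
\<close>

lemma fractional_partition_of_functional:
  fixes L :: "('a set \<Rightarrow> real) \<Rightarrow> real" and k :: nat
  defines "R \<equiv> conn_sets M E k"
  assumes add: "\<And>f g. f \<in> bounded_functions \<Longrightarrow> g \<in> bounded_functions \<Longrightarrow> L (\<lambda>Y. f Y + g Y) = L f + L g"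
    and scale: "\<And>f c. f \<in> bounded_functions \<Longrightarrow> L (\<lambda>Y. c * f Y) = c * L f"
    and neg: "\<And>f. f \<in> bounded_functions \<Longrightarrow> (\<And>Y. Y \<in> R \<Longrightarrow> f Y \<le> 0) \<Longrightarrow> L f \<le> 0"
    and avg: "\<And>g. g \<in> borel_measurable M \<Longrightarrow> bounded (g ` space M) \<Longrightarrow>
      L (\<lambda>Y. indicator R Y * average g Y) = (\<integral>x. g x \<partial>M)"
  obtains \<tau> where "\<tau> \<in> fractional_partitions M E k"
    "\<And>f. f \<in> borel_measurable (conn_space M E k) \<Longrightarrow> finite (f ` R) \<Longrightarrow>
      (\<integral>Y. f Y \<partial>\<tau>) = L (\<lambda>Y. indicator R Y * f Y)"
proof -
  let ?C = "sets (conn_space M E k)"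
  \<comment> \<open>Since \<open>neg\<close> looks only at values on \<open>R\<close>, so does
    monotonicity; hence \<open>L\<close> is insensitive to values off \<open>R\<close>.\<close>
  have mono: "L f \<le> L g" if "f \<in> bounded_functions" "g \<in> bounded_functions" "\<And>Y. Y \<in> R \<Longrightarrow> f Y \<le> g Y" for f g
  proof -
    have "(\<lambda>Y. f Y + (-1) * g Y) \<in> bounded_functions"
      by (intro bounded_functions.add bounded_functions.scale that)
    then have "L (\<lambda>Y. f Y + (-1) * g Y) \<le> 0" using that(3) by (intro neg) auto
    moreover have "L (\<lambda>Y. f Y + (-1) * g Y) = L f + (-1) * L g"
      by (simp only: add[OF that(1) bounded_functions.scale[OF that(2)]] scale[OF that(2)])
    ultimately show ?thesis by simp
  qed
  have zero: "L (\<lambda>Y. 0) = 0" using scale[OF bounded_functions.zero, of 0] by simp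
  have lin: "L (\<lambda>Y. \<Sum>i\<in>I. c i * f i Y) = (\<Sum>i\<in>I. c i * L (f i)) \<and>
      (\<lambda>Y. \<Sum>i\<in>I. c i * f i Y) \<in> bounded_functions"
    if "finite I" "\<And>i. f i \<in> bounded_functions" for I :: "real set" and c f
    using that(1)
  proof induction
    case empty
    then show ?case by (simp add: zero bounded_functions.zero)
  next
    case (insert i I)
    have "(\<lambda>Y. c i * f i Y) \<in> bounded_functions" by (intro bounded_functions.scale that)
    then show ?case
      using insert by (simp add: add bounded_functions.add scale that)
  qed
  have avg_bounded: "(\<lambda>Y. indicator R Y * average g Y) \<in> bounded_functions"
    if "\<And>x. x \<in> space M \<Longrightarrow> \<bar>g x\<bar> \<le> B" "0 \<le> B" for g B
    unfolding bounded_functions_def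
    using average_bound[of _ k g B, OF _ that(1)] that(2)
    by (auto simp: R_def indicator_def intro!: exI[of _ B])
  define \<mu> where "\<mu> F = ennreal (L (indicator F))" for F
  have L_nonneg: "0 \<le> L (indicator F)" for F
    using mono[OF bounded_functions.zero indicator_bounded[of F]] by (simp add: zero)
  have sa: "sigma_algebra R ?C"
    using sets.sigma_algebra_axioms[of "conn_space M E k"] by (simp add: space_conn_space R_def)
  interpret C: sigma_algebra R ?C by (rule sa)
  have "indicator {} = (\<lambda>Y :: 'a set. 0 :: real)" by (simp add: fun_eq_iff)
  then have pos: "positive ?C \<mu>"
    by (simp add: positive_def \<mu>_def zero)
  have "additive ?C \<mu>"
    unfolding additive_def
  proof (intro ballI impI)
    fix A B :: "'a set set" assume "A \<inter> B = {}"
    then have "indicator (A \<union> B) = (\<lambda>Y. indicator A Y + indicator B Y :: real)"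
      by (auto simp: indicator_def fun_eq_iff)
    then show "\<mu> (A \<union> B) = \<mu> A + \<mu> B"
      by (simp add: \<mu>_def add indicator_bounded ennreal_plus L_nonneg)
  qed
  moreover have "(\<lambda>i. \<mu> (A i)) \<longlonglongrightarrow> 0" if A: "range A \<subseteq> ?C" "decseq A" "(\<Inter>i. A i) = {}" for A
  proof -
    have "L (indicator (A i)) \<le> measure M (\<Union>(A i))" for i
    proof -
      have "A i \<in> ?C" using A(1) by auto
      then have X: "\<Union>(A i) \<in> sets M" by (rule Union_conn_space_measurable)
      let ?g = "indicator (\<Union>(A i)) :: 'a \<Rightarrow> real"
      have "L (indicator (A i)) \<le> L (\<lambda>Y. indicator R Y * average ?g Y)"
      proof (rule mono)
        fix Y assume Y: "Y \<in> R"
        show "indicator (A i) Y \<le> indicator R Y * average ?g Y"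
        proof (cases "Y \<in> A i")
          case True
          then show ?thesis using Y conn_setsD(1,2)[of Y k] average_indicator_Union[of Y "A i"]
            by (simp add: R_def)
        next
          case False
          then show ?thesis by (simp add: average_def sum_nonneg)
        qed
      qed (auto intro: indicator_bounded avg_bounded[of _ 1])
      also have "\<dots> = (\<integral>x. ?g x \<partial>M)"
        using X by (intro avg) (auto intro: bounded_indicator)
      finally show ?thesis using X by simp
    qed
    then have "(\<lambda>i. L (indicator (A i))) \<longlonglongrightarrow> 0"
      by (intro tendsto_sandwich[OF _ _ tendsto_const measure_Union_tendsto_0[OF A]]
          always_eventually allI L_nonneg)
    from tendsto_ennrealI[OF this] show ?thesis by (simp add: \<mu>_def)
  qed
  ultimately have ca: "countably_additive ?C \<mu>"
    by (intro C.empty_continuous_imp_countably_additive pos) (auto simp: \<mu>_def)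
  define \<tau> where "\<tau> = measure_of R ?C \<mu>"
  have sets_\<tau>: "sets \<tau> = ?C" unfolding \<tau>_def by (rule C.sets_measure_of_eq)
  have space_\<tau>: "space \<tau> = R" unfolding \<tau>_def by (rule C.space_measure_of_eq)
  have em: "emeasure \<tau> F = ennreal (L (indicator F))" if "F \<in> ?C" for F
    unfolding \<tau>_def using emeasure_measure_of_sigma[OF sa pos ca that] by (simp add: \<mu>_def)
  have L_cong: "L f = L g"
    if "f \<in> bounded_functions" "g \<in> bounded_functions" "\<And>Y. Y \<in> R \<Longrightarrow> f Y = g Y" for f g
    using mono[OF that(1,2)] mono[OF that(2,1)] that(3) by force
  interpret \<tau>: prob_space \<tau>
  proof
    have "L (indicator R) = L (\<lambda>Y. indicator R Y * average (\<lambda>_. 1) Y)"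
    proof (rule L_cong)
      fix Y assume "Y \<in> R"
      then show "indicator R Y = indicator R Y * average (\<lambda>_. 1) Y"
        using conn_setsD(4)[of Y k] by (simp add: average_def R_def)
    qed (auto intro: indicator_bounded avg_bounded[of _ 1])
    also have "\<dots> = (\<integral>x. 1 \<partial>M)" by (rule avg) (auto intro: bounded_subset[of "{1}"])
    also have "\<dots> = 1" by (simp add: prob_space)
    finally show "emeasure \<tau> (space \<tau>) = 1" using em[of R] by (simp add: space_\<tau>)
  qed
  \<comment> \<open>The integrands to which this is applied, covered fractions and expansions, take
    finitely many values because the counts in them are bounded. They are finite combinations of
    indicators, so linearity alone identifies the two sides.\<close>
  have integral: "(\<integral>Y. f Y \<partial>\<tau>) = L (\<lambda>Y. indicator R Y * f Y)"
    if f: "f \<in> borel_measurable (conn_space M E k)" and fin: "finite (f ` R)" for f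
  proof -
    define F where "F v = f -` {v} \<inter> R" for v
    have F: "F v \<in> ?C" for v
      using measurable_sets[OF f, of "{v}"] by (simp add: F_def space_conn_space R_def)
    have f_eq: "f Y = (\<Sum>v\<in>f ` R. v * indicator (F v) Y)" if "Y \<in> R" for Y
    proof -
      have "(\<Sum>v\<in>f ` R. v * indicator (F v) Y) = (\<Sum>v\<in>f ` R. if v = f Y then v else 0)"
        using that by (intro sum.cong) (auto simp: F_def indicator_def)
      then show ?thesis using fin that by simp
    qed
    have "(\<integral>Y. f Y \<partial>\<tau>) = (\<integral>Y. (\<Sum>v\<in>f ` R. v * indicator (F v) Y) \<partial>\<tau>)"
    proof (rule Bochner_Integration.integral_cong[OF refl])
      fix Y assume "Y \<in> space \<tau>"
      then show "f Y = (\<Sum>v\<in>f ` R. v * indicator (F v) Y)" by (intro f_eq) (simp add: space_\<tau>)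
    qed
    also have "\<dots> = (\<Sum>v\<in>f ` R. \<integral>Y. v * indicator (F v) Y \<partial>\<tau>)"
    proof (rule Bochner_Integration.integral_sum)
      fix v
      have "integrable \<tau> (indicator (F v) :: _ \<Rightarrow> real)"
        using F[of v] by (intro integrable_real_indicator) (simp_all add: sets_\<tau> \<tau>.emeasure_eq_measure)
      then show "integrable \<tau> (\<lambda>Y. v * indicator (F v) Y)" by (rule integrable_mult_right)
    qed
    also have "\<dots> = (\<Sum>v\<in>f ` R. v * L (indicator (F v)))"
      using F by (intro sum.cong) (auto simp: sets_\<tau> measure_def em L_nonneg)
    also have "\<dots> = L (\<lambda>Y. \<Sum>v\<in>f ` R. v * indicator (F v) Y)"
      using lin[OF fin, of "\<lambda>v. indicator (F v)" "\<lambda>v. v", OF indicator_bounded] by simp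
    also have "\<dots> = L (\<lambda>Y. indicator R Y * f Y)"
    proof (rule L_cong)
      show "(\<lambda>Y. \<Sum>v\<in>f ` R. v * indicator (F v) Y) \<in> bounded_functions"
        using lin[OF fin, of "\<lambda>v. indicator (F v)" "\<lambda>v. v", OF indicator_bounded] by simp
      obtain B where "\<forall>v\<in>f ` R. \<bar>v\<bar> \<le> B" using finite_imp_bounded[OF fin] by (auto simp: bounded_iff)
      then show "(\<lambda>Y. indicator R Y * f Y) \<in> bounded_functions"
        by (auto simp: bounded_functions_def indicator_def intro!: exI[of _ "max 0 B"])
      fix Y assume "Y \<in> R"
      then show "(\<Sum>v\<in>f ` R. v * indicator (F v) Y) = indicator R Y * f Y"
        using f_eq[of Y] by simp
    qed
    finally show ?thesis .
  qed
  have "marginal \<tau> X = emeasure M X" if X: "X \<in> sets M" for X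
  proof -
    let ?f = "\<lambda>Y. real (card (X \<inter> Y)) / real (card Y)"
    have f: "?f \<in> borel_measurable (conn_space M E k)" by (rule measurable_fraction[OF X])
    have le1: "?f Y \<le> 1" if "Y \<in> R" for Y
      using that conn_setsD(1)[of Y k] card_mono[of Y "X \<inter> Y"] conn_setsD(4)[of Y k]
      by (simp add: R_def)
    have "?f ` R \<subseteq> (\<lambda>(a, b). real a / real b) ` ({..k} \<times> {..k})"
    proof
      fix v assume "v \<in> ?f ` R"
      then obtain Y where Y: "Y \<in> R" "v = ?f Y" by blast
      have "card (X \<inter> Y) \<le> card Y" "card Y \<le> k"
        using Y(1) conn_setsD(1,5)[of Y k] card_mono[of Y "X \<inter> Y"] by (auto simp: R_def)
      then show "v \<in> (\<lambda>(a, b). real a / real b) ` ({..k} \<times> {..k})"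
        using Y(2) by (intro image_eqI[of _ _ "(card (X \<inter> Y), card Y)"]) auto
    qed
    then have fin: "finite (?f ` R)" by (rule finite_subset) simp
    have "marginal \<tau> X = ennreal (\<integral>Y. ?f Y \<partial>\<tau>)"
      unfolding marginal_def
    proof (rule nn_integral_eq_integral)
      show "integrable \<tau> ?f"
        using f le1 by (intro \<tau>.integrable_const_bound[of _ 1]) (auto simp: space_\<tau> sets_\<tau> cong: measurable_cong_sets)
    qed auto
    also have "(\<integral>Y. ?f Y \<partial>\<tau>) = L (\<lambda>Y. indicator R Y * ?f Y)" by (rule integral[OF f fin])
    also have "(\<lambda>Y. indicator R Y * ?f Y) = (\<lambda>Y. indicator R Y * average (indicator X) Y)"
    proof (rule ext)
      fix Y
      show "indicator R Y * ?f Y = indicator R Y * average (indicator X) Y"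
        using conn_setsD(1)[of Y k] by (cases "Y \<in> R") (simp_all add: average_indicator R_def)
    qed
    also have "L \<dots> = (\<integral>x. indicator X x \<partial>M)"
      using X by (intro avg) (auto intro: bounded_indicator)
    finally show ?thesis using X by (simp add: emeasure_eq_measure)
  qed
  then have "\<tau> \<in> fractional_partitions M E k"
    using \<tau>.prob_space_axioms sets_\<tau> by (simp add: fractional_partitions_def)
  then show thesis using that[of \<tau>] integral by blast
qed

section \<open>The upper integral and strong duality\<close>

definition dominating :: "nat \<Rightarrow> ('a set \<Rightarrow> real) \<Rightarrow> ('a \<Rightarrow> real) set" where
  "dominating k f = {g \<in> borel_measurable M. bounded (g ` space M) \<and>
     (\<forall>Y\<in>conn_sets M E k. f Y \<le> average g Y)}"

definition upper_integral :: "nat \<Rightarrow> ('a set \<Rightarrow> real) \<Rightarrow> real" where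
  "upper_integral k f = (INF g\<in>dominating k f. \<integral>x. g x \<partial>M)"

lemma dominating_nonempty:
  assumes "f \<in> bounded_functions"
  shows "dominating k f \<noteq> {}"
proof -
  obtain B where B: "\<And>Y. \<bar>f Y\<bar> \<le> B" using assms by (auto simp: bounded_functions_def)
  have "f Y \<le> average (\<lambda>_. B) Y" if "Y \<in> conn_sets M E k" for Y
    using conn_setsD(4)[OF that] B[of Y] by (simp add: average_def)
  then have "(\<lambda>_. B) \<in> dominating k f"
    by (auto simp: dominating_def intro: bounded_subset[of "{B}"])
  then show ?thesis by blast
qed

text \<open>Singletons are connected sets, so a dominating function is bounded below pointwise. This
  keeps the infimum in \<open>upper_integral\<close> over a set bounded below.\<close>

lemma dominating_integral_ge:
  assumes g: "g \<in> dominating k f" and k: "k \<ge> 1" and f: "\<And>Y. - B \<le> f Y"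
  shows "- B \<le> (\<integral>x. g x \<partial>M)"
proof -
  have "- B \<le> g x" if x: "x \<in> space M" for x
  proof -
    have "f {x} \<le> average g {x}"
      using g singleton_conn_sets[OF x k] by (auto simp: dominating_def)
    then show ?thesis using f[of "{x}"] by (simp add: average_def)
  qed
  moreover have "integrable M g" using g by (intro integrable_bounded) (auto simp: dominating_def)
  ultimately have "(\<integral>x. - B \<partial>M) \<le> (\<integral>x. g x \<partial>M)" by (intro integral_mono) auto
  then show ?thesis by (simp add: prob_space)
qed

lemma upper_integral_le:
  assumes k: "k \<ge> 1" and f: "f \<in> bounded_functions" and g: "g \<in> dominating k f"
  shows "upper_integral k f \<le> (\<integral>x. g x \<partial>M)"
proof -
  obtain B where "\<And>Y. \<bar>f Y\<bar> \<le> B" using f by (auto simp: bounded_functions_def)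
  then have B: "\<And>Y. - B \<le> f Y" by (metis abs_le_D2 minus_le_iff)
  then have "bdd_below ((\<lambda>g. \<integral>x. g x \<partial>M) ` dominating k f)"
    by (intro bdd_belowI2[of _ "- B"] dominating_integral_ge[OF _ k])
  then show ?thesis unfolding upper_integral_def using g by (rule cINF_lower)
qed

lemma upper_integral_greatest:
  assumes "f \<in> bounded_functions" "\<And>g. g \<in> dominating k f \<Longrightarrow> a \<le> (\<integral>x. g x \<partial>M)"
  shows "a \<le> upper_integral k f"
  unfolding upper_integral_def using dominating_nonempty[OF assms(1)] assms(2) by (rule cINF_greatest)

lemma average_add: "average (\<lambda>x. f x + g x) Y = average f Y + average g Y"
  by (simp add: average_def sum.distrib algebra_simps)

lemma average_scale: "average (\<lambda>x. c * g x) Y = c * average g Y"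
  by (simp add: average_def flip: sum_distrib_left)

lemma dominating_add:
  assumes "g \<in> dominating k f" "g' \<in> dominating k f'"
  shows "(\<lambda>x. g x + g' x) \<in> dominating k (\<lambda>Y. f Y + f' Y)"
  using assms by (auto simp: dominating_def average_add intro!: bounded_plus_comp add_mono)

lemma dominating_scale:
  assumes "g \<in> dominating k f" "c > 0"
  shows "(\<lambda>x. c * g x) \<in> dominating k (\<lambda>Y. c * f Y)"
  using assms bounded_scaling[of "g ` space M" c]
  by (auto simp: dominating_def average_scale image_image)

lemma sublinear_upper_integral:
  assumes k: "k \<ge> 1"
  shows "bounded_functions.sublinear (upper_integral k)"
  unfolding bounded_functions.sublinear_def
proof (intro conjI ballI allI impI)
  fix f f' :: "'a set \<Rightarrow> real" assume f: "f \<in> bounded_functions" and f': "f' \<in> bounded_functions"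
  have *: "upper_integral k (\<lambda>Y. f Y + f' Y) \<le> (\<integral>x. g x \<partial>M) + (\<integral>x. g' x \<partial>M)"
    if "g \<in> dominating k f" "g' \<in> dominating k f'" for g g'
  proof -
    have "upper_integral k (\<lambda>Y. f Y + f' Y) \<le> (\<integral>x. g x + g' x \<partial>M)"
      using that by (intro upper_integral_le k bounded_functions.add f f' dominating_add)
    also have "\<dots> = (\<integral>x. g x \<partial>M) + (\<integral>x. g' x \<partial>M)"
      using that by (intro Bochner_Integration.integral_add integrable_bounded) (auto simp: dominating_def)
    finally show ?thesis .
  qed
  have "upper_integral k (\<lambda>Y. f Y + f' Y) - (\<integral>x. g x \<partial>M) \<le> upper_integral k f'"
    if "g \<in> dominating k f" for g
    using *[OF that] by (intro upper_integral_greatest f') (simp add: algebra_simps)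
  then have "upper_integral k (\<lambda>Y. f Y + f' Y) - upper_integral k f' \<le> upper_integral k f"
    by (intro upper_integral_greatest f) (simp add: algebra_simps)
  then show "upper_integral k (\<lambda>Y. f Y + f' Y) \<le> upper_integral k f + upper_integral k f'" by simp
next
  fix f :: "'a set \<Rightarrow> real" and c :: real assume f: "f \<in> bounded_functions" and c: "0 < c"
  have "upper_integral k (\<lambda>Y. c * f Y) / c \<le> upper_integral k f"
  proof (rule upper_integral_greatest[OF f])
    fix g assume g: "g \<in> dominating k f"
    have "upper_integral k (\<lambda>Y. c * f Y) \<le> (\<integral>x. c * g x \<partial>M)"
      by (intro upper_integral_le k bounded_functions.scale f dominating_scale g c)
    then show "upper_integral k (\<lambda>Y. c * f Y) / c \<le> (\<integral>x. g x \<partial>M)"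
      using c by (simp add: field_simps)
  qed
  then show "upper_integral k (\<lambda>Y. c * f Y) \<le> c * upper_integral k f"
    using c by (simp add: field_simps)
qed

lemma strong_duality:
  assumes k: "k \<ge> 1"
    and S: "\<And>g. g \<in> borel_measurable M \<Longrightarrow> bounded (g ` space M) \<Longrightarrow>
      (\<And>Y. Y \<in> conn_sets M E k \<Longrightarrow> average g Y \<le> expansion E Y) \<Longrightarrow> (\<integral>x. g x \<partial>M) \<le> S"
  obtains \<tau> where "\<tau> \<in> fractional_partitions M E k" "(\<integral>Y. expansion E Y \<partial>\<tau>) \<le> S"
proof -
  define R where "R = conn_sets M E k"
  \<comment> \<open>The sign turns the constraint on averages into a domination: a function
    dominates \<open>f0\<close> exactly when its negative is feasible, so the infimum at
    \<open>f0\<close> is minus the supremum of the dual problem.\<close>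
  define f0 where "f0 Y = - (indicator R Y * expansion E Y)" for Y
  have f0: "f0 \<in> bounded_functions"
    using expansion_bound[of _ k]
    by (auto simp: bounded_functions_def f0_def R_def indicator_def intro!: exI[of _ "real D"])
  obtain L where add: "\<And>f g. f \<in> bounded_functions \<Longrightarrow> g \<in> bounded_functions \<Longrightarrow> L (\<lambda>x. f x + g x) = L f + L g"
    and scale: "\<And>f c. f \<in> bounded_functions \<Longrightarrow> L (\<lambda>x. c * f x) = c * L f"
    and le: "\<And>f. f \<in> bounded_functions \<Longrightarrow> L f \<le> upper_integral k f"
    and L_f0: "L f0 = upper_integral k f0"
    using bounded_functions.hahn_banach[OF sublinear_upper_integral[OF k] f0] by blast
  have avg_bounded: "(\<lambda>Y. indicator R Y * average g Y) \<in> bounded_functions"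
    if g: "bounded (g ` space M)" for g
  proof -
    obtain B where B: "\<And>x. x \<in> space M \<Longrightarrow> \<bar>g x\<bar> \<le> B" using g by (auto simp: bounded_iff)
    have "\<bar>indicator R Y * average g Y\<bar> \<le> max 0 B" for Y
      using average_bound[of Y k g B, OF _ B] by (cases "Y \<in> R") (auto simp: R_def)
    then show ?thesis by (auto simp: bounded_functions_def)
  qed
  have avg_le: "L (\<lambda>Y. indicator R Y * average g Y) \<le> (\<integral>x. g x \<partial>M)"
    if g: "g \<in> borel_measurable M" "bounded (g ` space M)" for g
  proof -
    have "g \<in> dominating k (\<lambda>Y. indicator R Y * average g Y)"
      using g by (auto simp: dominating_def R_def)
    then show ?thesis
      using le[OF avg_bounded[OF g(2)]] upper_integral_le[OF k avg_bounded[OF g(2)]] by force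
  qed
  obtain \<tau> where \<tau>: "\<tau> \<in> fractional_partitions M E k"
    and int: "\<And>f. f \<in> borel_measurable (conn_space M E k) \<Longrightarrow> finite (f ` R) \<Longrightarrow>
      (\<integral>Y. f Y \<partial>\<tau>) = L (\<lambda>Y. indicator R Y * f Y)"
  proof (rule fractional_partition_of_functional[of L k, folded R_def])
    fix f :: "'a set \<Rightarrow> real" assume f: "f \<in> bounded_functions" and neg: "\<And>Y. Y \<in> R \<Longrightarrow> f Y \<le> 0"
    \<comment> \<open>The zero function dominates everything that is nonpositive on the connected
      sets; positivity of \<open>L\<close> follows.\<close>
    have "(\<lambda>_. 0) \<in> dominating k f"
      using neg by (auto simp: dominating_def average_def R_def intro: bounded_subset[of "{0}"])
    then have "upper_integral k f \<le> (\<integral>x. 0 \<partial>M)" by (rule upper_integral_le[OF k f])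
    then show "L f \<le> 0" using le[OF f] by simp
  next
    fix g :: "'a \<Rightarrow> real" assume g: "g \<in> borel_measurable M" "bounded (g ` space M)"
    show "L (\<lambda>Y. indicator R Y * average g Y) = (\<integral>x. g x \<partial>M)"
    proof (rule antisym)
      show "L (\<lambda>Y. indicator R Y * average g Y) \<le> (\<integral>x. g x \<partial>M)" by (rule avg_le[OF g])
      \<comment> \<open>A function dominates its own averages, which gives one inequality; the same
        bound for \<open>- g\<close> and linearity of \<open>L\<close> give the other.\<close>
      have "bounded ((\<lambda>x. -1 * g x) ` space M)"
        using bounded_scaling[OF g(2), of "-1"] by (simp add: image_image)
      then have "L (\<lambda>Y. indicator R Y * average (\<lambda>x. -1 * g x) Y) \<le> (\<integral>x. -1 * g x \<partial>M)"
        using g(1) by (intro avg_le) auto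
      also have "(\<lambda>Y. indicator R Y * average (\<lambda>x. -1 * g x) Y) = (\<lambda>Y. -1 * (indicator R Y * average g Y))"
        unfolding average_scale by simp
      also have "L \<dots> = -1 * L (\<lambda>Y. indicator R Y * average g Y)"
        by (rule scale[OF avg_bounded[OF g(2)]])
      finally show "(\<integral>x. g x \<partial>M) \<le> L (\<lambda>Y. indicator R Y * average g Y)" by simp
    qed
  qed (use add scale in auto)
  \<comment> \<open>At most \<open>D * k\<close> boundary edges and at most \<open>k\<close> points
    leave finitely many quotients, so the integral formula for finitely-valued functions applies to
    \<open>expansion E\<close>.\<close>
  have "expansion E ` R \<subseteq> (\<lambda>(a, b). real a / real b) ` ({..D * k} \<times> {..k})"
  proof
    fix v assume "v \<in> expansion E ` R"
    then obtain Y where Y: "Y \<in> conn_sets M E k" "v = expansion E Y" by (auto simp: R_def)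
    have "card (edge_boundary E Y) \<le> D * k"
      using card_edge_boundary_le[OF conn_setsD(1)[OF Y(1)]] conn_setsD(5)[OF Y(1)]
      by (meson le_trans mult_le_mono2)
    then show "v \<in> (\<lambda>(a, b). real a / real b) ` ({..D * k} \<times> {..k})"
      using Y conn_setsD(5)[OF Y(1)]
      by (intro image_eqI[of _ _ "(card (edge_boundary E Y), card Y)"]) (auto simp: expansion_def)
  qed
  then have "finite (expansion E ` R)" by (rule finite_subset) simp
  then have "(\<integral>Y. expansion E Y \<partial>\<tau>) = L (\<lambda>Y. indicator R Y * expansion E Y)"
    by (rule int[OF measurable_expansion])
  also have "\<dots> = L (\<lambda>Y. -1 * f0 Y)" by (simp add: f0_def)
  also have "\<dots> = - upper_integral k f0" using scale[OF f0, of "-1"] L_f0 by simp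
  finally have eq: "(\<integral>Y. expansion E Y \<partial>\<tau>) = - upper_integral k f0" .
  have "- S \<le> upper_integral k f0"
  proof (rule upper_integral_greatest[OF f0])
    fix g assume g: "g \<in> dominating k f0"
    have "(\<integral>x. -1 * g x \<partial>M) \<le> S"
    proof (rule S)
      show "(\<lambda>x. -1 * g x) \<in> borel_measurable M" using g by (auto simp: dominating_def)
      show "bounded ((\<lambda>x. -1 * g x) ` space M)"
        using g bounded_scaling[of "g ` space M" "-1"] by (simp add: dominating_def image_image)
      fix Y assume "Y \<in> conn_sets M E k"
      then show "average (\<lambda>x. -1 * g x) Y \<le> expansion E Y"
        using g unfolding average_scale by (auto simp: dominating_def f0_def R_def)
    qed
    then show "- S \<le> (\<integral>x. g x \<partial>M)" by simp
  qed
  then have "(\<integral>Y. expansion E Y \<partial>\<tau>) \<le> S" using eq by simp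
  then show thesis using that[OF \<tau>] by blast
qed

lemma average_le_expansion_iff:
  assumes "Y \<in> conn_sets M E k"
  shows "average g Y \<le> expansion E Y \<longleftrightarrow> (\<Sum>y\<in>Y. g y) \<le> real (card (edge_boundary E Y))"
  using conn_setsD(4)[OF assms] by (simp add: average_def expansion_def divide_le_cancel)

end

theorem theorem15:
  fixes D k :: nat and M :: "'a measure" and E :: "('a \<times> 'a) set"
  assumes "D \<ge> 1" and "k \<ge> 1" and "graphing D M E"
  shows "sep_star M E k =
      (SUP g\<in>{g. g \<in> borel_measurable M \<and> bounded (g ` space M) \<and>
                  (\<forall>Y\<in>conn_sets M E k. average g Y \<le> expansion E Y)}.
         1 / 2 * (\<integral>x. g x \<partial>M))
    \<and> (\<forall>g :: 'a \<Rightarrow> real.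
         (\<forall>Y\<in>conn_sets M E k. average g Y \<le> expansion E Y) \<longleftrightarrow>
         (\<forall>Y\<in>conn_sets M E k. (\<Sum>y\<in>Y. g y) \<le> real (card (edge_boundary E Y))))"
proof
  interpret graphing D M E by fact
  let ?G = "{g. g \<in> borel_measurable M \<and> bounded (g ` space M) \<and>
    (\<forall>Y\<in>conn_sets M E k. average g Y \<le> expansion E Y)}"
  let ?T = "fractional_partitions M E k"
  have weak: "1 / 2 * (\<integral>x. g x \<partial>M) \<le> 1 / 2 * (\<integral>Y. expansion E Y \<partial>\<tau>)" if "\<tau> \<in> ?T" "g \<in> ?G" for \<tau> g
    using weak_duality[OF that(1), of g] that(2) by simp
  define S where "S = (SUP g\<in>?G. 1 / 2 * (\<integral>x. g x \<partial>M))"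
  have zero: "(\<lambda>_. 0) \<in> ?G"
    using expansion_bound(1) by (auto simp: average_def intro: bounded_subset[of "{0}"])
  \<comment> \<open>Singletons bound a feasible \<open>g\<close> pointwise by \<open>D\<close>, so
    the supremum is over a set bounded above; \<open>zero\<close> makes that set nonempty.\<close>
  have "(\<integral>x. g x \<partial>M) \<le> D" if g: "g \<in> ?G" for g
  proof -
    have "g x \<le> D" if x: "x \<in> space M" for x
    proof -
      have "{x} \<in> conn_sets M E k" using x \<open>k \<ge> 1\<close> by (rule singleton_conn_sets)
      then have "average g {x} \<le> D" using g expansion_bound(2)[of "{x}" k] by fastforce
      then show ?thesis by (simp add: average_def)
    qed
    then have "(\<integral>x. g x \<partial>M) \<le> (\<integral>x. real D \<partial>M)"
      using g by (intro integral_mono integrable_const) (auto intro: integrable_bounded)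
    then show ?thesis by (simp add: prob_space)
  qed
  then have "bdd_above ((\<lambda>g. 1 / 2 * (\<integral>x. g x \<partial>M)) ` ?G)"
    by (intro bdd_aboveI2[of _ _ "1 / 2 * real D"]) auto
  then have "1 / 2 * (\<integral>x. g x \<partial>M) \<le> S" if "g \<in> ?G" for g
    unfolding S_def using that by (intro cSUP_upper)
  then have S_upper: "(\<integral>x. g x \<partial>M) \<le> 2 * S" if "g \<in> ?G" for g
    using that by fastforce
  have "S \<le> 1 / 2 * (\<integral>Y. expansion E Y \<partial>\<tau>)" if "\<tau> \<in> ?T" for \<tau>
    unfolding S_def using zero weak[OF that] by (intro cSUP_least) blast+
  then have S_le: "2 * S \<le> (\<integral>Y. expansion E Y \<partial>\<tau>)" if "\<tau> \<in> ?T" for \<tau>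
    using that by fastforce
  \<comment> \<open>An optimal partition meets the lower bound that weak duality sets for all
    partitions. The factor \<open>2\<close> undoes the \<open>1 / 2\<close> built into
    \<open>S\<close>.\<close>
  obtain \<tau> where \<tau>: "\<tau> \<in> ?T" "(\<integral>Y. expansion E Y \<partial>\<tau>) \<le> 2 * S"
    by (rule strong_duality[OF \<open>k \<ge> 1\<close>, of "2 * S"]) (use S_upper in \<open>auto\<close>)
  have "2 * S \<le> (INF \<tau>\<in>?T. \<integral>Y. expansion E Y \<partial>\<tau>)"
    using \<tau>(1) S_le by (intro cINF_greatest) auto
  moreover have "(INF \<tau>\<in>?T. \<integral>Y. expansion E Y \<partial>\<tau>) \<le> (\<integral>Y. expansion E Y \<partial>\<tau>)"
    using S_le \<tau>(1) by (intro cINF_lower bdd_belowI2[of _ "2 * S"]) auto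
  ultimately show "sep_star M E k = (SUP g\<in>?G. 1 / 2 * (\<integral>x. g x \<partial>M))"
    using \<tau>(2) unfolding sep_star_def S_def[symmetric] by simp
  show "\<forall>g. (\<forall>Y\<in>conn_sets M E k. average g Y \<le> expansion E Y) \<longleftrightarrow>
      (\<forall>Y\<in>conn_sets M E k. (\<Sum>y\<in>Y. g y) \<le> real (card (edge_boundary E Y)))"
    using average_le_expansion_iff by blast
qed

end
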